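(* For a finitely generated group $G$ the following are equivalent: (1) for some finite generating set $S$ of $G$ closed under inverses there is a constant $K$ with $\Delta_S(n)\le n/6+K$ for all $n\ge1$; (2) $G$ is (word) hyperbolic; (3) for every finite generating set $S$ of $G$ closed under inverses there are constants $Q,R$ with $\Delta_S(n)\le Q\log n+R$ for all $n\ge1$.
   Context: For a finite generating set $S$ of $G$ closed under inverses, $\Gamma$ is the Cayley diagram (edge labelled $s$ from $g$ to $gs$), with word metric $d(g,g')$ = length of a shortest word in $S$ representing $g^{-1}g'$, extended to $\Gamma$ by making each edge isometric to the unit interval. A cycle of length $n\ge1$ is a sequence $g_0,\dots,g_n$ in $G$ with an edge from each $g_{i-1}$ to $g_i$ and $g_n=g_0$. A (diagonal) triangulation of a circle: distinguish one or more points on the circle and join some of them by chords such that no two chords meet in the interior, the interior is divided into triangles, and each arc between neighbouring distinguished points is a side of a triangle; circles with at most three distinguished points count as triangulated with no chords. A triangulation of the cycle $g_0,\dots,g_n$ is such a triangulation of a circle with distinguished points $p_1,\dots,p_n$ labelled $g_1,\dots,g_n$ counterclockwise; a chord from $p_i$ to $p_j$ has length $d(g_i,g_j)$; a $k$-triangulation has all chord lengths $\le k$. $\Delta_S(n)$ is the least $k$ such that every cycle of length at most $n$ in $\Gamma$ has a $k$-triangulation. $\log$ is to base 2. $G$ is hyperbolic if for some (equivalently any) such $S$ there is $\delta$ such that in every geodesic triangle in $\Gamma$ each point of any side is within distance $\delta$ of some point on one of the other two sides. *)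

theory Defs
  imports Complex_Main "HOL-Algebra.Generated_Groups"
begin

definition word_eval :: "('a,'b) monoid_scheme \<Rightarrow> 'a list \<Rightarrow> 'a" where
  "word_eval G w = foldr (\<lambda>s x. s \<otimes>\<^bsub>G\<^esub> x) w \<one>\<^bsub>G\<^esub>"

definition word_len :: "('a,'b) monoid_scheme \<Rightarrow> 'a set \<Rightarrow> 'a \<Rightarrow> nat" where
  "word_len G S g = (LEAST n. \<exists>w. set w \<subseteq> S \<and> length w = n \<and> word_eval G w = g)"

definition wdist :: "('a,'b) monoid_scheme \<Rightarrow> 'a set \<Rightarrow> 'a \<Rightarrow> 'a \<Rightarrow> nat" where
  "wdist G S g h = word_len G S (inv\<^bsub>G\<^esub> g \<otimes>\<^bsub>G\<^esub> h)"

definition sym_gen_set :: "('a,'b) monoid_scheme \<Rightarrow> 'a set \<Rightarrow> bool" where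
  "sym_gen_set G S \<longleftrightarrow> finite S \<and> S \<subseteq> carrier G \<and> (\<forall>s\<in>S. inv\<^bsub>G\<^esub> s \<in> S)
      \<and> generate G S = carrier G"

definition finitely_generated :: "('a,'b) monoid_scheme \<Rightarrow> bool" where
  "finitely_generated G \<longleftrightarrow> (\<exists>S. finite S \<and> S \<subseteq> carrier G \<and> generate G S = carrier G)"

definition is_cycle :: "('a,'b) monoid_scheme \<Rightarrow> 'a set \<Rightarrow> (nat \<Rightarrow> 'a) \<Rightarrow> nat \<Rightarrow> bool" where
  "is_cycle G S c n \<longleftrightarrow> n \<ge> 1 \<and> (\<forall>i\<le>n. c i \<in> carrier G)
      \<and> (\<forall>i\<in>{1..n}. \<exists>s\<in>S. c i = c (i - 1) \<otimes>\<^bsub>G\<^esub> s) \<and> c n = c 0"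

text \<open>poly_tri i j C: C is the set of chords of a (diagonal) triangulation of the
  polygon with consecutive distinguished points i, i+1, ..., j, where the side (i,j)
  is already a side (arc or chord) and is not counted in C.  Polygons with at most
  three distinguished points are triangulated with no chords; otherwise the
  triangle containing the side (i,j) has an apex m with i < m < j, which splits
  the polygon into the polygons i..m and m..j.\<close>
inductive poly_tri :: "nat \<Rightarrow> nat \<Rightarrow> (nat \<times> nat) set \<Rightarrow> bool" where
  small: "i \<le> j \<Longrightarrow> j \<le> i + 2 \<Longrightarrow> poly_tri i j {}"
| split: "i < m \<Longrightarrow> m < j \<Longrightarrow> poly_tri i m C1 \<Longrightarrow> poly_tri m j C2 \<Longrightarrow>
     poly_tri i j (C1 \<union> C2 \<union> (if i + 1 < m then {(i,m)} else {}) \<union> (if m + 1 < j then {(m,j)} else {}))"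

text \<open>Triangulations of the circle with distinguished points p_1..p_n (counterclockwise):
  the arc between p_n and p_1 is the base side.\<close>
definition circle_triangulation :: "nat \<Rightarrow> (nat \<times> nat) set \<Rightarrow> bool" where
  "circle_triangulation n C \<longleftrightarrow> poly_tri 1 n C"

definition has_k_triangulation ::
    "('a,'b) monoid_scheme \<Rightarrow> 'a set \<Rightarrow> (nat \<Rightarrow> 'a) \<Rightarrow> nat \<Rightarrow> nat \<Rightarrow> bool" where
  "has_k_triangulation G S c n k \<longleftrightarrow>
     (\<exists>C. circle_triangulation n C \<and> (\<forall>(i,j)\<in>C. wdist G S (c i) (c j) \<le> k))"

definition Delta :: "('a,'b) monoid_scheme \<Rightarrow> 'a set \<Rightarrow> nat \<Rightarrow> nat" where
  "Delta G S n = (LEAST k. \<forall>c m. m \<le> n \<longrightarrow> is_cycle G S c m \<longrightarrow> has_k_triangulation G S c m k)"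

text \<open>Points of the metric Cayley graph: (g,s,t) is the point at distance t along the
  edge labelled s from g to g s (t = 0 is the vertex g, t = 1 the vertex g s).\<close>
definition cg_points :: "('a,'b) monoid_scheme \<Rightarrow> 'a set \<Rightarrow> ('a \<times> 'a \<times> real) set" where
  "cg_points G S = {(g,s,t). g \<in> carrier G \<and> s \<in> S \<and> 0 \<le> t \<and> t \<le> 1}"

text \<open>The path metric (each edge isometric to the unit interval): either move inside a
  common edge, or leave through endpoints and travel between vertices in the word metric.\<close>
definition cg_dist :: "('a,'b) monoid_scheme \<Rightarrow> 'a set \<Rightarrow> 'a \<times> 'a \<times> real \<Rightarrow> 'a \<times> 'a \<times> real \<Rightarrow> real" where
  "cg_dist G S p q = (case p of (g,s,t) \<Rightarrow> case q of (h,u,r) \<Rightarrow>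
     (let via = min (min (t + real (wdist G S g h) + r)
                         (t + real (wdist G S g (h \<otimes>\<^bsub>G\<^esub> u)) + (1 - r)))
                    (min ((1 - t) + real (wdist G S (g \<otimes>\<^bsub>G\<^esub> s) h) + r)
                         ((1 - t) + real (wdist G S (g \<otimes>\<^bsub>G\<^esub> s) (h \<otimes>\<^bsub>G\<^esub> u)) + (1 - r)))
      in if g = h \<and> s = u then min \<bar>t - r\<bar> via else via))"

definition cg_geodesic ::
    "('a,'b) monoid_scheme \<Rightarrow> 'a set \<Rightarrow> (real \<Rightarrow> 'a \<times> 'a \<times> real) \<Rightarrow> real
       \<Rightarrow> 'a \<times> 'a \<times> real \<Rightarrow> 'a \<times> 'a \<times> real \<Rightarrow> bool" where
  "cg_geodesic G S gam L x y \<longleftrightarrow> 0 \<le> L \<and> gam 0 = x \<and> gam L = y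
     \<and> (\<forall>a\<in>{0..L}. gam a \<in> cg_points G S)
     \<and> (\<forall>a\<in>{0..L}. \<forall>b\<in>{0..L}. cg_dist G S (gam a) (gam b) = \<bar>a - b\<bar>)"

definition side_close ::
    "('a,'b) monoid_scheme \<Rightarrow> 'a set \<Rightarrow> real \<Rightarrow> (real \<Rightarrow> 'a \<times> 'a \<times> real) \<Rightarrow> real
       \<Rightarrow> (real \<Rightarrow> 'a \<times> 'a \<times> real) \<Rightarrow> real \<Rightarrow> (real \<Rightarrow> 'a \<times> 'a \<times> real) \<Rightarrow> real \<Rightarrow> bool" where
  "side_close G S \<delta> gam1 L1 gam2 L2 gam3 L3 \<longleftrightarrow>
     (\<forall>a\<in>{0..L1}. \<exists>p \<in> gam2 ` {0..L2} \<union> gam3 ` {0..L3}. cg_dist G S (gam1 a) p \<le> \<delta>)"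

definition hyperbolic_wrt :: "('a,'b) monoid_scheme \<Rightarrow> 'a set \<Rightarrow> bool" where
  "hyperbolic_wrt G S \<longleftrightarrow> (\<exists>\<delta>. \<forall>x y z gam1 L1 gam2 L2 gam3 L3.
     cg_geodesic G S gam1 L1 x y \<longrightarrow> cg_geodesic G S gam2 L2 y z \<longrightarrow> cg_geodesic G S gam3 L3 z x \<longrightarrow>
       side_close G S \<delta> gam1 L1 gam2 L2 gam3 L3 \<and>
       side_close G S \<delta> gam2 L2 gam3 L3 gam1 L1 \<and>
       side_close G S \<delta> gam3 L3 gam1 L1 gam2 L2)"

definition hyperbolic_group :: "('a,'b) monoid_scheme \<Rightarrow> bool" where
  "hyperbolic_group G \<longleftrightarrow> (\<exists>S. sym_gen_set G S \<and> hyperbolic_wrt G S)"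

end

theory Submission
  imports Defs
begin

text \<open>
  If \<open>\<Delta>(n) \<le> n/6 + K\<close>, every triangulated cycle of length \<open>n\<close> has a chord of length about
  \<open>n/6\<close> that leaves at least a third of the cycle on either side. Cutting along it gives cycles of
  lengths \<open>n\<^sub>1, n\<^sub>2\<close> with \<open>n\<^sub>1\<^sup>2 + n\<^sub>2\<^sup>2 \<le> 17/18 n\<^sup>2 + O(n)\<close>. Signed area under any pair of 1-Lipschitz
  functions is additive under such cuts, so by iteration it is \<open>o(n\<^sup>2)\<close>. On the other hand a walk
  that joins two points of a geodesic outside a ball of radius \<open>r\<close> about an intermediate point closes
  up to a cycle which suitable Lipschitz functions map onto the boundary of a rectangle of area
  proportional to \<open>r\<^sup>2\<close>. Hence such walks are superlinearly long in \<open>r\<close>. A point of a geodesic side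
  of a bigon or triangle at maximal distance \<open>r\<close> from the other sides would give one of length \<open>O(r)\<close>,
  so \<open>r\<close> is bounded.

  Conversely, in a hyperbolic group a path of length \<open>n\<close> passes within \<open>O(log n)\<close> of each point of the
  geodesic between its endpoints. Hence a chord of length \<open>B = O(log n)\<close> of a cycle can be replaced by
  two chords of length at most \<open>B\<close>, through a vertex close to its midpoint. A
  logarithmic bound passes to other generating sets because triangulations can be collapsed along
  monotone maps.
\<close>

section \<open>Polygon triangulations\<close>

text \<open>The number 17/18 is (1/2)^2 + (5/6)^2: in the worst case the pieces n/3 and 2n/3 are
  each lengthened by a chord n/6. The sum of squares would stay below n^2 for every fraction up to
  about 0.187 in place of 1/6. Signed area under test functions replaces a filling area because it
  is exactly additive under cuts, and because one well chosen pair of functions already gives the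
  lower bound. The obstacle is discretisation. Sides of a geodesic triangle may start inside edges,
  so their vertices form geodesics only up to an additive error, and consecutive ones need not be
  adjacent. Hence closed walks with steps up to 4 must be cut, while the hypothesis concerns cycles
  of edges. Subdividing n such steps gives a cycle of at most 4n edges with chords of about 4n/6;
  such a chord is crossed again in about n/6 steps of size 4, so the critical fraction
  survives.\<close>

definition tri :: "(nat \<Rightarrow> nat \<Rightarrow> bool) \<Rightarrow> nat \<Rightarrow> nat \<Rightarrow> bool" where
  "tri P i j \<longleftrightarrow> (\<exists>C. poly_tri i j C \<and> (\<forall>(a,b)\<in>C. P a b))"

lemma tri_small: "i \<le> j \<Longrightarrow> j \<le> i + 2 \<Longrightarrow> tri P i j"
  unfolding tri_def using poly_tri.small by blast

lemma tri_split:
  assumes "i < m" "m < j" "tri P i m" "tri P m j" "P i m" "P m j"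
  shows "tri P i j"
proof -
  obtain C1 C2 where "poly_tri i m C1" "poly_tri m j C2"
    and "\<forall>(a,b)\<in>C1. P a b" "\<forall>(a,b)\<in>C2. P a b"
    using assms(3,4) unfolding tri_def by blast
  then show ?thesis
    unfolding tri_def using poly_tri.split[OF assms(1,2)] assms(5,6) by (fastforce split: if_splits)
qed

lemma poly_tri_bounds:
  "poly_tri i j C \<Longrightarrow> i \<le> j \<and> (\<forall>(a,b)\<in>C. i \<le> a \<and> a < b \<and> b \<le> j)"
  by (induction rule: poly_tri.induct) (fastforce split: if_splits)+

lemma tri_mono:
  assumes "tri P i j" and "\<And>a b. i \<le> a \<Longrightarrow> a < b \<Longrightarrow> b \<le> j \<Longrightarrow> P a b \<Longrightarrow> Q a b"
  shows "tri Q i j"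
proof -
  obtain C where C: "poly_tri i j C" "\<forall>(a,b)\<in>C. P a b"
    using assms(1) unfolding tri_def by blast
  have "\<forall>(a,b)\<in>C. Q a b"
    using C poly_tri_bounds[OF C(1)] assms(2) by blast
  with C(1) show ?thesis unfolding tri_def by blast
qed

lemma tri_exists:
  assumes "i \<le> j" shows "tri (\<lambda>_ _. True) i j"
  using assms
proof (induction "j - i" arbitrary: i rule: less_induct)
  case less
  show ?case
  proof (cases "j \<le> i + 2")
    case False
    then have "tri (\<lambda>_ _. True) (Suc i) j" by (intro less.hyps) auto
    then show ?thesis
      using False by (intro tri_split[of i "Suc i" j]) (auto intro: tri_small)
  qed (use less tri_small in auto)
qed

text \<open>A triangle either keeps three distinct corners under \<open>f\<close> or flattens
  because the apex meets an end of the base; in the second case the triangulation of the other half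
  already serves. This transports triangulations from a subdivided cycle to the original
  walk.\<close>

lemma tri_collapse:
  assumes "tri P i j"
    and step: "\<And>p. i \<le> p \<Longrightarrow> p < j \<Longrightarrow> f p \<le> f (Suc p) \<and> f (Suc p) \<le> Suc (f p)"
    and PQ: "\<And>a b. i \<le> a \<Longrightarrow> a < b \<Longrightarrow> b \<le> j \<Longrightarrow> P a b \<Longrightarrow> Q (f a) (f b)"
  shows "tri Q (f i) (f j)"
proof -
  obtain C where C: "poly_tri i j C" "\<forall>(a,b)\<in>C. P a b"
    using assms(1) unfolding tri_def by blast
  have lip: "f b \<le> f a + (b - a)" if "i \<le> a" "a \<le> b" "b \<le> j" for a b
    using that(2,3)
  proof (induction b rule: dec_induct)
    case (step n)
    then show ?case using assms(2)[of n] that(1) by auto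
  qed auto
  have mono: "f a \<le> f b" if "i \<le> a" "a \<le> b" "b \<le> j" for a b
    using that(2,3)
  proof (induction b rule: dec_induct)
    case (step n)
    then show ?case using assms(2)[of n] that(1) by auto
  qed auto
  have "i \<le> i'' \<Longrightarrow> j'' \<le> j \<Longrightarrow> (\<forall>(a,b)\<in>C. P a b) \<Longrightarrow> tri Q (f i'') (f j'')"
    if "poly_tri i'' j'' C" for i'' j'' C
    using that
  proof (induction rule: poly_tri.induct)
    case (small a b)
    then show ?case using lip[of a b] mono[of a b] by (intro tri_small) auto
  next
    case (split a m b C1 C2)
    have 1: "tri Q (f a) (f m)" using split by auto
    have 2: "tri Q (f m) (f b)" using split by auto
    have le: "f a \<le> f m" "f m \<le> f b" using split mono by auto
    consider "f a = f m" | "f m = f b" | "f a < f m" "f m < f b" using le by linarith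
    then show ?case
    proof cases
      case 3
      show ?thesis
      proof (cases "f b \<le> f a + 2")
        case True
        then show ?thesis using le by (intro tri_small) auto
      next
        case False
        have Q1: "a + 1 < m \<Longrightarrow> Q (f a) (f m)" "m + 1 < b \<Longrightarrow> Q (f m) (f b)"
          using split PQ by auto
        obtain D1 D2 where D: "poly_tri (f a) (f m) D1" "poly_tri (f m) (f b) D2"
          "\<forall>(a,b)\<in>D1. Q a b" "\<forall>(a,b)\<in>D2. Q a b" using 1 2 unfolding tri_def by blast
        \<comment> \<open>As \<open>f\<close> advances by at most 1, a side that was an arc cannot
          become a chord. So every side that must be counted now was counted before, and
          \<open>Q\<close> is known for it.\<close>
        have "a + 1 < m" if "f a + 1 < f m"
          using lip[of a m] that split by auto
        moreover have "m + 1 < b" if "f m + 1 < f b"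
          using lip[of m b] that split by auto
        ultimately show ?thesis
          using poly_tri.split[OF 3 D(1,2)] D(3,4) Q1 unfolding tri_def
          by (fastforce split: if_splits)
      qed
    qed (use 1 2 in auto)
  qed
  from this[OF C(1) _ _ C(2)] show ?thesis by simp
qed

text \<open>Descend from the base into a half that still spans more than \<open>2 * T\<close>. When
  neither half does, one of them spans more than \<open>T\<close>, since together they exceed
  \<open>2 * T\<close>. Its side is a chord and not an arc because \<open>T\<close> is at least
  1.\<close>

lemma tri_balanced_chord:
  assumes "tri P i j" "1 \<le> T" "2 * T < j - i"
  shows "\<exists>a b. i \<le> a \<and> b \<le> j \<and> a + T < b \<and> b \<le> a + 2 * T \<and> P a b"
proof -
  have "2 * T < j - i \<Longrightarrow> \<exists>(a,b)\<in>C. a + T < b \<and> b \<le> a + 2 * T" if "poly_tri i j C" for C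
    using that
  proof (induction rule: poly_tri.induct)
    case (small i j)
    then show ?case using assms(2) by auto
  next
    case (split i m j C1 C2)
    show ?case
    proof (cases "2 * T < m - i \<or> 2 * T < j - m")
      case True
      then show ?thesis using split.IH by blast
    next
      case False
      then consider "i + T < m" "m \<le> i + 2 * T" | "m + T < j" "j \<le> m + 2 * T"
        using split.prems split.hyps by linarith
      then show ?thesis
        by cases (use assms(2) in auto)
    qed
  qed
  moreover obtain C where C: "poly_tri i j C" "\<forall>(a,b)\<in>C. P a b"
    using assms(1) unfolding tri_def by blast
  ultimately obtain a b where "(a, b) \<in> C" "a + T < b" "b \<le> a + 2 * T"
    using assms(3) by blast
  then show ?thesis using C(2) poly_tri_bounds[OF C(1)] by blast
qed

section \<open>Area enclosed by a closed path under two functions\<close>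

text \<open>Twice the signed area enclosed by the polygon with vertices \<open>(f (c i), g (c i))\<close>.\<close>

definition area :: "('a \<Rightarrow> real) \<Rightarrow> ('a \<Rightarrow> real) \<Rightarrow> (nat \<Rightarrow> 'a) \<Rightarrow> nat \<Rightarrow> real" where
  "area f g c n = (\<Sum>i<n. f (c i) * g (c (Suc i)) - f (c (Suc i)) * g (c i))"

definition join :: "(nat \<Rightarrow> 'a) \<Rightarrow> nat \<Rightarrow> (nat \<Rightarrow> 'a) \<Rightarrow> nat \<Rightarrow> 'a" where
  "join c n e = (\<lambda>i. if i \<le> n then c i else e (i - n))"

lemma area_shift: "area f g c (a + k) = area f g c a + area f g (\<lambda>i. c (a + i)) k"
  unfolding area_def by (induction k) auto

lemma area_cong: "(\<And>i. i \<le> n \<Longrightarrow> c i = e i) \<Longrightarrow> area f g c n = area f g e n"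
  unfolding area_def by (intro sum.cong) auto

lemma area_join:
  assumes "c n = e 0"
  shows "area f g (join c n e) (n + m) = area f g c n + area f g e m"
proof -
  have "area f g (join c n e) n = area f g c n"
    by (intro area_cong) (simp add: join_def)
  moreover have "area f g (\<lambda>i. join c n e (n + i)) m = area f g e m"
    using assms by (intro area_cong) (auto simp: join_def)
  ultimately show ?thesis by (simp add: area_shift)
qed

lemma area_rev: "area f g (\<lambda>i. c (n - i)) n = - area f g c n"
proof -
  have "area f g (\<lambda>i. c (n - i)) n =
    (\<Sum>i<n. f (c (n - Suc i + 1)) * g (c (n - Suc i)) - f (c (n - Suc i)) * g (c (n - Suc i + 1)))"
    unfolding area_def by (intro sum.cong) (auto simp: Suc_diff_Suc)
  also have "\<dots> = (\<Sum>i<n. f (c (i + 1)) * g (c i) - f (c i) * g (c (i + 1)))"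
    using sum.nat_diff_reindex[of "\<lambda>i. f (c (i + 1)) * g (c i) - f (c i) * g (c (i + 1))" n] by simp
  also have "\<dots> = - area f g c n"
    unfolding area_def by (simp add: sum_negf[symmetric])
  finally show ?thesis .
qed

text \<open>The correction terms telescope around the closed path. Both functions may thus be
  normalised to vanish at the base point.\<close>

lemma area_translate:
  assumes "c n = c 0"
  shows "area (\<lambda>x. f x - \<alpha>) (\<lambda>x. g x - \<beta>) c n = area f g c n"
proof -
  have "area (\<lambda>x. f x - \<alpha>) (\<lambda>x. g x - \<beta>) c n =
    area f g c n - \<alpha> * (\<Sum>i<n. g (c (Suc i)) - g (c i)) + \<beta> * (\<Sum>i<n. f (c (Suc i)) - f (c i))"
    unfolding area_def sum_distrib_left sum_subtractf[symmetric] sum.distrib[symmetric]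
    by (intro sum.cong) (auto simp: algebra_simps)
  moreover have "(\<Sum>i<n. h (c (Suc i)) - h (c i)) = 0" for h :: "'a \<Rightarrow> real"
    using assms by (simp add: sum_lessThan_telescope[of "\<lambda>i. h (c i)"])
  ultimately show ?thesis by simp
qed

text \<open>By convexity the worst \<open>l\<close> is an end of its interval, which the product of
  the two linear factors expresses. Relaxing 34/36 to 35/36 leaves room for the terms in
  \<open>k\<close>, which are small once \<open>192 * k \<le> n\<close>.\<close>

lemma balanced_split_bound:
  fixes n l m k :: real
  assumes "n / 3 \<le> l" "l \<le> 2 * n / 3" "0 \<le> m" "m \<le> n / 6 + k" "0 \<le> k" "192 * k \<le> n"
  shows "(l + m)\<^sup>2 + (n - l + m)\<^sup>2 \<le> 35 / 36 * n\<^sup>2"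
proof -
  have n: "0 \<le> n" using assms by linarith
  have "(l - n / 3) * (l - 2 * n / 3) \<le> 0"
    using assms by (intro mult_nonneg_nonpos) auto
  moreover have "l\<^sup>2 + (n - l)\<^sup>2 = 5 / 9 * n\<^sup>2 + 2 * ((l - n / 3) * (l - 2 * n / 3))"
    by (simp add: power2_eq_square field_simps)
  ultimately have 1: "l\<^sup>2 + (n - l)\<^sup>2 \<le> 5 / 9 * n\<^sup>2" by linarith
  have "m * n \<le> (n / 6 + k) * n" using assms n by (intro mult_right_mono) auto
  then have 2: "m * n \<le> n\<^sup>2 / 6 + k * n" by (simp add: power2_eq_square algebra_simps)
  have "m\<^sup>2 \<le> (n / 6 + k)\<^sup>2" using assms by (intro power_mono) auto
  then have 3: "m\<^sup>2 \<le> n\<^sup>2 / 36 + k * n / 3 + k * k" by (simp add: power2_eq_square algebra_simps)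
  have "k * n \<le> n / 192 * n" using assms n by (intro mult_right_mono) auto
  then have 4: "k * n \<le> n\<^sup>2 / 192" by (simp add: power2_eq_square)
  have "k * k \<le> n / 192 * (n / 192)" using assms n by (intro mult_mono) auto
  then have 5: "k * k \<le> n\<^sup>2 / 36864" by (simp add: power2_eq_square)
  have "(l + m)\<^sup>2 + (n - l + m)\<^sup>2 = l\<^sup>2 + (n - l)\<^sup>2 + 2 * (m * n) + 2 * m\<^sup>2"
    by (simp add: power2_eq_square algebra_simps)
  then show ?thesis using 1 2 3 4 5 zero_le_power2[of n] by linarith
qed

lemma exists_max_index:
  fixes h :: "nat \<Rightarrow> nat"
  obtains k where "k \<le> N" "\<And>i. i \<le> N \<Longrightarrow> h i \<le> h k"
proof -
  have "Max (h ` {..N}) \<in> h ` {..N}" by (intro Max_in) auto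
  then obtain k where "k \<in> {..N}" "Max (h ` {..N}) = h k" by blast
  moreover have "h i \<le> Max (h ` {..N})" if "i \<le> N" for i using that by (intro Max_ge) auto
  ultimately show ?thesis using that by auto
qed

lemma min_four_eqI:
  fixes e :: real
  assumes "e \<le> w" "e \<le> x" "e \<le> y" "e \<le> z" "e \<in> {w, x, y, z}"
  shows "min (min w x) (min y z) = e"
  using assms by (auto simp: min_def)

section \<open>Closed walks enclose subquadratic area\<close>

text \<open>This abstracts the vertex set with its word metric. The area estimates, thin triangles
  and logarithmic triangulations are all proved at this level; group structure returns only when
  walks are turned into cycles and when points inside edges are compared with vertices.\<close>

locale geodesic_graph =
  fixes V :: "'a set" and d :: "'a \<Rightarrow> 'a \<Rightarrow> nat"
  assumes d_refl [simp]: "x \<in> V \<Longrightarrow> d x x = 0"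
    and sym: "x \<in> V \<Longrightarrow> y \<in> V \<Longrightarrow> d x y = d y x"
    and triangle: "x \<in> V \<Longrightarrow> y \<in> V \<Longrightarrow> z \<in> V \<Longrightarrow> d x z \<le> d x y + d y z"
    and geodesic: "x \<in> V \<Longrightarrow> y \<in> V \<Longrightarrow> \<exists>v. v 0 = x \<and> v (d x y) = y \<and>
      (\<forall>i\<le>d x y. v i \<in> V) \<and> (\<forall>j\<le>d x y. \<forall>i\<le>j. d (v i) (v j) = j - i)"
begin

definition walk :: "nat \<Rightarrow> 'a set \<Rightarrow> (nat \<Rightarrow> 'a) \<Rightarrow> nat \<Rightarrow> bool" where
  "walk s X c n \<longleftrightarrow> (\<forall>i\<le>n. c i \<in> X) \<and> (\<forall>i<n. d (c i) (c (Suc i)) \<le> s)"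

definition linked :: "nat \<Rightarrow> 'a set \<Rightarrow> 'a \<Rightarrow> 'a \<Rightarrow> nat \<Rightarrow> bool" where
  "linked s X x y n \<longleftrightarrow> (\<exists>c m. m \<le> n \<and> walk s X c m \<and> c 0 = x \<and> c m = y)"

definition lip :: "('a \<Rightarrow> real) \<Rightarrow> bool" where
  "lip f \<longleftrightarrow> (\<forall>x\<in>V. \<forall>y\<in>V. \<bar>f x - f y\<bar> \<le> real (d x y))"

lemma walk_join:
  assumes "walk s X c n" "walk s X e m" "c n = e 0"
  shows "walk s X (join c n e) (n + m)"
  unfolding walk_def
proof (intro conjI allI impI)
  fix i assume "i \<le> n + m"
  then show "join c n e i \<in> X" using assms unfolding walk_def join_def by auto
next
  fix i assume i: "i < n + m"
  consider "i < n" | "i = n" | "n < i" by linarith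
  then show "d (join c n e i) (join c n e (Suc i)) \<le> s"
  proof cases
    case 2
    then have "join c n e i = e 0" "join c n e (Suc i) = e (Suc 0)" "0 < m"
      using assms i unfolding join_def by auto
    then show ?thesis using assms(2) unfolding walk_def by auto
  next
    case 3
    then have "join c n e i = e (i - n)" "join c n e (Suc i) = e (Suc (i - n))" "i - n < m"
      using i unfolding join_def by (auto simp: Suc_diff_le)
    then show ?thesis using assms(2) unfolding walk_def by auto
  qed (use assms(1) in \<open>auto simp: walk_def join_def\<close>)
qed

lemma walk_rev:
  assumes "walk s X c n" "X \<subseteq> V"
  shows "walk s X (\<lambda>i. c (n - i)) n"
  unfolding walk_def
proof (intro conjI allI impI)
  fix i assume i: "i < n"
  then have "d (c (n - Suc i)) (c (Suc (n - Suc i))) \<le> s" "c (n - Suc i) \<in> V" "c (n - i) \<in> V"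
    using assms unfolding walk_def by auto
  then show "d (c (n - i)) (c (n - Suc i)) \<le> s" using sym i by (simp add: Suc_diff_Suc)
qed (use assms in \<open>auto simp: walk_def\<close>)

lemma walk_mono: "walk s X c n \<Longrightarrow> X \<subseteq> Y \<Longrightarrow> s \<le> t \<Longrightarrow> walk t Y c n"
  unfolding walk_def by fastforce

lemma walk_sub: "walk s X c n \<Longrightarrow> a + k \<le> n \<Longrightarrow> walk s X (\<lambda>i. c (a + i)) k"
  unfolding walk_def by auto

lemma walk_dist:
  assumes "walk s V c n" "i \<le> j" "j \<le> n"
  shows "d (c i) (c j) \<le> s * (j - i)"
  using assms(2,3)
proof (induction j rule: dec_induct)
  case base
  then show ?case using assms(1) unfolding walk_def by auto
next
  case (step j)
  have "d (c i) (c (Suc j)) \<le> d (c i) (c j) + d (c j) (c (Suc j))"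
    using step assms(1) unfolding walk_def by (intro triangle) auto
  also have "\<dots> \<le> s * (j - i) + s"
    using step assms(1) unfolding walk_def by (intro add_mono) auto
  finally show ?case using step by (simp add: Suc_diff_le)
qed

lemma linked_trans:
  assumes "linked s X x y n" "linked s X y z m" shows "linked s X x z (n + m)"
proof -
  obtain c n' e m' where "n' \<le> n" "walk s X c n'" "c 0 = x" "c n' = y"
    "m' \<le> m" "walk s X e m'" "e 0 = y" "e m' = z"
    using assms unfolding linked_def by blast
  then show ?thesis unfolding linked_def
    by (intro exI[of _ "join c n' e"] exI[of _ "n' + m'"]) (auto simp: walk_join, auto simp: join_def)
qed

lemma linked_sym:
  assumes "linked s X x y n" "X \<subseteq> V" shows "linked s X y x n"
proof -
  obtain c m where "m \<le> n" "walk s X c m" "c 0 = x" "c m = y"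
    using assms unfolding linked_def by blast
  then show ?thesis unfolding linked_def
    by (intro exI[of _ "\<lambda>i. c (m - i)"] exI[of _ m]) (auto simp: walk_rev assms(2))
qed

lemma linked_mono:
  "linked s X x y n \<Longrightarrow> X \<subseteq> Y \<Longrightarrow> s \<le> t \<Longrightarrow> n \<le> m \<Longrightarrow> linked t Y x y m"
  unfolding linked_def using walk_mono[of s X _ _ Y t] le_trans[of _ n m] by blast

text \<open>The vertex set recorded here is the metric interval between the ends. That a geodesic
  avoids a ball can then be shown for every point of the interval by the triangle inequality,
  without naming the geodesic.\<close>

lemma linked_geodesic:
  assumes "x \<in> V" "y \<in> V"
  shows "linked 1 {u \<in> V. d x u + d u y = d x y} x y (d x y)"
proof -
  obtain v where v: "v 0 = x" "v (d x y) = y" "\<forall>i\<le>d x y. v i \<in> V"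
    "\<forall>j\<le>d x y. \<forall>i\<le>j. d (v i) (v j) = j - i"
    using geodesic[OF assms] by blast
  have "d x (v i) + d (v i) y = d x y" if "i \<le> d x y" for i
    using v(4)[rule_format, of i 0] v(4)[rule_format, of "d x y" i] that v(1,2) by auto
  then have "walk 1 {u \<in> V. d x u + d u y = d x y} v (d x y)"
    using v unfolding walk_def by auto
  then show ?thesis unfolding linked_def using v by blast
qed

text \<open>The quotient is \<open>d x y / s\<close> rounded up: every \<open>s\<close>-th point of
  a geodesic is taken, and the \<open>min\<close> makes the last step stop at
  \<open>y\<close>.\<close>

lemma linked_coarse:
  assumes "x \<in> V" "y \<in> V" "0 < s"
  shows "linked s V x y ((d x y + (s - 1)) div s)"
proof -
  obtain v where v: "v 0 = x" "v (d x y) = y" "\<forall>i\<le>d x y. v i \<in> V"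
    "\<forall>j\<le>d x y. \<forall>i\<le>j. d (v i) (v j) = j - i"
    using geodesic[OF assms(1,2)] by blast
  define m where "m = (d x y + (s - 1)) div s"
  have "d x y \<le> s * m"
  proof -
    have "d x y + (s - 1) < s * (m + 1)"
      unfolding m_def using assms(3) by (metis Suc_eq_plus1 dividend_less_times_div mult_Suc_right)
    then show ?thesis using assms(3) by auto
  qed
  then have "walk s V (\<lambda>i. v (min (s * i) (d x y))) m" "min (s * m) (d x y) = d x y"
    using v unfolding walk_def by (auto simp: min_def)
  then show ?thesis unfolding linked_def m_def[symmetric] using v
    by (intro exI[of _ "\<lambda>i. v (min (s * i) (d x y))"] exI[of _ m]) auto
qed

text \<open>This crude bound starts the iteration. Once \<open>f\<close> and \<open>g\<close> vanish
  at the base point they are at most \<open>s * n\<close> along the walk and change by at most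
  \<open>s\<close> in a step.\<close>

lemma area_trivial_bound:
  assumes "walk s V c n" "c n = c 0" "lip f" "lip g"
  shows "\<bar>area f g c n\<bar> \<le> 2 * (real s)\<^sup>2 * (real n)\<^sup>2"
proof -
  define F G where "F = (\<lambda>x. f x - f (c 0))" and "G = (\<lambda>x. g x - g (c 0))"
  have inV: "c i \<in> V" if "i \<le> n" for i using assms(1) that unfolding walk_def by auto
  have far: "\<bar>h (c i) - h (c 0)\<bar> \<le> real s * real n" if "lip h" "i \<le> n" for h i
  proof -
    have "\<bar>h (c i) - h (c 0)\<bar> \<le> real (d (c i) (c 0))" using that inV unfolding lip_def by auto
    also have "d (c i) (c 0) \<le> s * i"
      using walk_dist[OF assms(1), of 0 i] that sym inV by auto
    also have "real (s * i) \<le> real s * real n" using that by (simp add: mult_left_mono)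
    finally show ?thesis by simp
  qed
  have near: "\<bar>h (c (Suc i)) - h (c i)\<bar> \<le> real s" if "lip h" "i < n" for h i
  proof -
    have "\<bar>h (c (Suc i)) - h (c i)\<bar> \<le> real (d (c (Suc i)) (c i))"
      using that inV unfolding lip_def by auto
    also have "d (c (Suc i)) (c i) \<le> s" using assms(1) that sym inV unfolding walk_def by auto
    finally show ?thesis by simp
  qed
  have "\<bar>area f g c n\<bar> = \<bar>area F G c n\<bar>"
    unfolding F_def G_def using area_translate[OF assms(2)] by simp
  also have "\<dots> \<le> (\<Sum>i<n. \<bar>F (c i) * G (c (Suc i)) - F (c (Suc i)) * G (c i)\<bar>)"
    unfolding area_def by (rule sum_abs)
  also have "\<dots> \<le> (\<Sum>i<n. 2 * (real s)\<^sup>2 * real n)"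
  proof (intro sum_mono)
    fix i assume "i \<in> {..<n}"
    then have i: "i < n" by simp
    have "F (c i) * G (c (Suc i)) - F (c (Suc i)) * G (c i)
        = F (c i) * (g (c (Suc i)) - g (c i)) - (f (c (Suc i)) - f (c i)) * G (c i)"
      unfolding F_def G_def by (simp add: algebra_simps)
    moreover have "\<bar>F (c i) * (g (c (Suc i)) - g (c i))\<bar> \<le> (real s * real n) * real s"
      unfolding abs_mult F_def using far[OF assms(3), of i] near[OF assms(4) i] i
      by (intro mult_mono) auto
    moreover have "\<bar>(f (c (Suc i)) - f (c i)) * G (c i)\<bar> \<le> real s * (real s * real n)"
      unfolding abs_mult G_def using far[OF assms(4), of i] near[OF assms(3) i] i
      by (intro mult_mono) auto
    ultimately show "\<bar>F (c i) * G (c (Suc i)) - F (c (Suc i)) * G (c i)\<bar> \<le> 2 * (real s)\<^sup>2 * real n"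
      by (simp add: power2_eq_square algebra_simps)
  qed
  also have "\<dots> = 2 * (real s)\<^sup>2 * (real n)\<^sup>2" by (simp add: power2_eq_square)
  finally show ?thesis .
qed

text \<open>The two closed walks traverse the shortcut in opposite directions, so its contributions
  cancel. The second walk runs from \<open>c b\<close> through the base point to \<open>c a\<close>.
  The pieces are chosen before \<open>f\<close> and \<open>g\<close>, so one cut serves all test
  functions.\<close>

lemma area_split:
  assumes "walk s V c n" "c n = c 0" "a \<le> b" "b \<le> n" "linked s V (c b) (c a) m0"
  obtains e1 e2 m where "m \<le> m0" "walk s V e1 (b - a + m)" "e1 (b - a + m) = e1 0"
    "walk s V e2 (n - b + a + m)" "e2 (n - b + a + m) = e2 0"
    "\<And>f g. area f g c n = area f g e1 (b - a + m) + area f g e2 (n - b + a + m)"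
proof -
  obtain q m where q: "m \<le> m0" "walk s V q m" "q 0 = c b" "q m = c a"
    using assms(5) unfolding linked_def by blast
  define p1 where "p1 = (\<lambda>i. c (a + i))"
  define p2 where "p2 = (\<lambda>i. c (b + i))"
  define e1 where "e1 = join p1 (b - a) q"
  define p3 where "p3 = join p2 (n - b) c"
  define e2 where "e2 = join p3 (n - b + a) (\<lambda>i. q (m - i))"
  have p1: "walk s V p1 (b - a)" "p1 (b - a) = q 0"
    unfolding p1_def using walk_sub[OF assms(1), of a "b - a"] assms q by auto
  have p2: "walk s V p2 (n - b)" "p2 (n - b) = c 0"
    unfolding p2_def using walk_sub[OF assms(1), of b "n - b"] assms q by auto
  have ca: "walk s V c a" using walk_sub[OF assms(1), of 0 a] assms by simp
  have p3: "walk s V p3 (n - b + a)" "p3 (n - b + a) = q (m - 0)"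
    unfolding p3_def using walk_join[OF p2(1) ca p2(2)] q p2(2) by (auto simp: join_def)
  have e1: "walk s V e1 (b - a + m)" "e1 (b - a + m) = e1 0"
    unfolding e1_def using walk_join[OF p1(1) q(2) p1(2)] q p1 by (auto simp: join_def p1_def)
  have e2: "walk s V e2 (n - b + a + m)" "e2 (n - b + a + m) = e2 0"
    unfolding e2_def using walk_join[OF p3(1) walk_rev[OF q(2)] p3(2)] q p3
    by (auto simp: join_def p3_def p2_def)
  have "area f g c n = area f g e1 (b - a + m) + area f g e2 (n - b + a + m)" for f g
  proof -
    have 1: "area f g e1 (b - a + m) = area f g p1 (b - a) + area f g q m"
      unfolding e1_def using p1 by (intro area_join)
    have 2: "area f g e2 (n - b + a + m) = area f g p3 (n - b + a) - area f g q m"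
      unfolding e2_def by (subst area_join) (use p3 in \<open>auto simp: area_rev\<close>)
    have 3: "area f g p3 (n - b + a) = area f g p2 (n - b) + area f g c a"
      unfolding p3_def using p2 by (intro area_join)
    have 4: "area f g c n = area f g c b + area f g p2 (n - b)"
      unfolding p2_def using area_shift[of f g c b "n - b"] assms by simp
    have 5: "area f g c b = area f g c a + area f g p1 (b - a)"
      unfolding p1_def using area_shift[of f g c a "b - a"] assms by simp
    show ?thesis using 1 2 3 4 5 by simp
  qed
  then show ?thesis using that q(1) e1 e2 by blast
qed

text \<open>The hypothesis is the chord bound 4n/6 + K with the denominator cleared. One balanced
  cut improves any valid constant by the factor 35/36, at the price of a larger threshold.\<close>

theorem area_subquadratic:
  assumes T: "\<And>c n. 1 \<le> n \<Longrightarrow> walk 4 V c n \<Longrightarrow> c n = c 0 \<Longrightarrow>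
      tri (\<lambda>i j. 6 * d (c i) (c j) \<le> 4 * n + 6 * K) 1 n"
    and "0 < \<epsilon>"
  shows "\<exists>N. \<forall>n\<ge>N. \<forall>c f g. walk 4 V c n \<longrightarrow> c n = c 0 \<longrightarrow> lip f \<longrightarrow> lip g \<longrightarrow>
     \<bar>area f g c n\<bar> \<le> \<epsilon> * (real n)\<^sup>2"
proof -
  define bd where "bd = (\<lambda>B N. \<forall>n\<ge>N. \<forall>c f g. walk 4 V c n \<longrightarrow> c n = c 0 \<longrightarrow> lip f \<longrightarrow> lip g \<longrightarrow>
     \<bar>area f g c n\<bar> \<le> B * (real n)\<^sup>2)"
  have step: "\<exists>N'. bd (35 / 36 * B) N'" if "bd B N" "0 \<le> B" for B N
  proof (intro exI)
    \<comment> \<open>\<open>3 * N\<close> keeps both pieces, each about a third of \<open>n\<close>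
      or more, in the range of the old bound; \<open>192 * (K + 1)\<close> is what
      \<open>balanced_split_bound\<close> asks for.\<close>
    show "bd (35 / 36 * B) (3 * N + 192 * (K + 1) + 4)" unfolding bd_def
    proof (intro allI impI)
      fix n c f g
      assume n: "3 * N + 192 * (K + 1) + 4 \<le> n" and c: "walk 4 V c n" "c n = c 0" and fg: "lip f" "lip g"
      \<comment> \<open>The strict inequality \<open>a + t < b\<close> obtained below makes up for
        the rounding, so \<open>b - a\<close> lies between n/3 and 2n/3.\<close>
      define t where "t = n div 3"
      have t: "1 \<le> t" "2 * t < n - 1" "3 * t \<le> n" "n < 3 * t + 3" unfolding t_def using n by linarith+
      obtain a b where ab: "1 \<le> a" "b \<le> n" "a + t < b" "b \<le> a + 2 * t"
        "6 * d (c a) (c b) \<le> 4 * n + 6 * K"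
        using tri_balanced_chord[OF T[OF _ c] t(1,2)] n by auto
      have inV: "c a \<in> V" "c b \<in> V" using c ab unfolding walk_def by auto
      obtain e1 e2 m where e: "m \<le> (d (c b) (c a) + (4 - 1)) div 4"
        "walk 4 V e1 (b - a + m)" "e1 (b - a + m) = e1 0"
        "walk 4 V e2 (n - b + a + m)" "e2 (n - b + a + m) = e2 0"
        "\<And>f g. area f g c n = area f g e1 (b - a + m) + area f g e2 (n - b + a + m)"
        using area_split[OF c, of a b] linked_coarse[OF inV(2,1), of 4] ab by (metis add_lessD1 less_imp_le zero_less_numeral)
      have m: "24 * m \<le> 4 * n + 6 * K + 18" using e(1) ab(5) sym[OF inV] by linarith
      have 1: "\<bar>area f g e1 (b - a + m)\<bar> \<le> B * (real (b - a + m))\<^sup>2"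
        using n t ab by (intro that(1)[unfolded bd_def, rule_format] e fg) auto
      have 2: "\<bar>area f g e2 (n - b + a + m)\<bar> \<le> B * (real (n - b + a + m))\<^sup>2"
        using n t ab by (intro that(1)[unfolded bd_def, rule_format] e fg) auto
      have "real (192 * (K + 1)) \<le> real n" using n by (intro of_nat_mono) linarith
      then have large: "192 * (real K + 1) \<le> real n" by simp
      have 3: "(real (b - a) + real m)\<^sup>2 + (real n - real (b - a) + real m)\<^sup>2 \<le> 35 / 36 * (real n)\<^sup>2"
        using m t ab n by (intro balanced_split_bound[where k = "real K + 1"] large) linarith+
      have eqs: "real (n - b + a + m) = real n - real (b - a) + real m" "real (b - a + m) = real (b - a) + real m"
        using ab by linarith+
      have "(real (b - a + m))\<^sup>2 + (real (n - b + a + m))\<^sup>2 \<le> 35 / 36 * (real n)\<^sup>2"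
        using 3 unfolding eqs .
      then have "B * ((real (b - a + m))\<^sup>2 + (real (n - b + a + m))\<^sup>2) \<le> B * (35 / 36 * (real n)\<^sup>2)"
        using that(2) by (intro mult_left_mono)
      then show "\<bar>area f g c n\<bar> \<le> 35 / 36 * B * (real n)\<^sup>2"
        using 1 2 e(6)[of f g] by (simp only: distrib_left mult.assoc[symmetric]) linarith
    qed
  qed
  have "\<exists>N. bd ((35 / 36) ^ k * 32) N" for k
  proof (induction k)
    case 0
    \<comment> \<open>32 is \<open>2 * s\<^sup>2\<close> for step size 4.\<close>
    have "bd 32 0" unfolding bd_def using area_trivial_bound[where s = 4] by fastforce
    then show ?case by auto
  next
    case (Suc k)
    then show ?case using step[of "(35 / 36) ^ k * 32"] by (auto simp: algebra_simps)
  qed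
  moreover obtain k where k: "(35 / 36 :: real) ^ k < \<epsilon> / 32"
    using real_arch_pow_inv[of "\<epsilon> / 32" "35 / 36"] assms(2) by auto
  ultimately obtain N where "bd ((35 / 36) ^ k * 32) N" by blast
  moreover have "bd \<epsilon> N" if "bd B N" "B \<le> \<epsilon>" for B
    unfolding bd_def
  proof (intro allI impI)
    fix n c f g
    assume "N \<le> n" "walk 4 V c n" "c n = c 0" "lip f" "lip g"
    then have "\<bar>area f g c n\<bar> \<le> B * (real n)\<^sup>2"
      by (intro that(1)[unfolded bd_def, rule_format])
    also have "\<dots> \<le> \<epsilon> * (real n)\<^sup>2" using that(2) by (intro mult_right_mono) auto
    finally show "\<bar>area f g c n\<bar> \<le> \<epsilon> * (real n)\<^sup>2" .
  qed
  ultimately have "bd \<epsilon> N" using k by auto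
  then show ?thesis unfolding bd_def by blast
qed

section \<open>Superlinear divergence and thin triangles\<close>

text \<open>The constant 3 covers the vertices read off at integer times from a geodesic of the metric
  graph; steps of such a sequence have length at most 4, which is why walks with steps up to 4
  are used throughout.\<close>

definition cgeo :: "(nat \<Rightarrow> 'a) \<Rightarrow> nat \<Rightarrow> bool" where
  "cgeo v N \<longleftrightarrow> (\<forall>i\<le>N. v i \<in> V) \<and>
    (\<forall>j\<le>N. \<forall>i\<le>j. d (v i) (v j) \<le> j - i + 3 \<and> j - i \<le> d (v i) (v j) + 3)"

section \<open>Distance to a set, and coarse geodesics\<close>

definition dset :: "'a set \<Rightarrow> 'a \<Rightarrow> nat" where
  "dset X u = (LEAST m. \<exists>x\<in>X. d u x = m)"

lemma dset_le: "x \<in> X \<Longrightarrow> dset X u \<le> d u x"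
  unfolding dset_def by (rule Least_le) auto

lemma dset_attained:
  assumes "X \<noteq> {}" obtains x where "x \<in> X" "d u x = dset X u"
proof -
  have "\<exists>m. \<exists>x\<in>X. d u x = m" using assms by auto
  then have "\<exists>x\<in>X. d u x = dset X u"
    unfolding dset_def by (rule LeastI_ex)
  then show ?thesis using that by blast
qed

lemma dset_lip:
  assumes "X \<subseteq> V" "X \<noteq> {}" "u \<in> V" "w \<in> V"
  shows "dset X u \<le> d u w + dset X w"
proof -
  obtain x where x: "x \<in> X" "d w x = dset X w" using dset_attained[OF assms(2)] .
  have "dset X u \<le> d u x" using x by (intro dset_le)
  also have "\<dots> \<le> d u w + d w x" using x assms by (intro triangle) auto
  finally show ?thesis using x by simp
qed

lemma cgeo_in: "cgeo v N \<Longrightarrow> i \<le> N \<Longrightarrow> v i \<in> V"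
  unfolding cgeo_def by auto

lemma cgeo_upper:
  assumes "cgeo v N" "i \<le> N" "j \<le> N" "i \<le> j + m" "j \<le> i + m"
  shows "d (v i) (v j) \<le> m + 3"
proof -
  have "d (v i) (v j) = d (v j) (v i)" using assms by (intro sym) (auto simp: cgeo_def)
  moreover have "i \<le> j \<or> j \<le> i" by linarith
  moreover have "j - i \<le> m" "i - j \<le> m" using assms by linarith+
  ultimately show ?thesis using assms unfolding cgeo_def by (smt (verit) add_le_cancel_right le_trans)
qed

lemma cgeo_lower:
  assumes "cgeo v N" "i \<le> N" "j \<le> N"
  shows "i \<le> j + d (v i) (v j) + 3" "j \<le> i + d (v i) (v j) + 3"
proof -
  have "d (v i) (v j) = d (v j) (v i)" using assms by (intro sym) (auto simp: cgeo_def)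
  moreover have "i \<le> j \<Longrightarrow> j - i \<le> d (v i) (v j) + 3" "j \<le> i \<Longrightarrow> i - j \<le> d (v j) (v i) + 3"
    using assms unfolding cgeo_def by auto
  ultimately show "i \<le> j + d (v i) (v j) + 3" "j \<le> i + d (v i) (v j) + 3" by linarith+
qed

lemma cgeo_sub:
  assumes "cgeo v N" "a + k \<le> N" shows "cgeo (\<lambda>i. v (a + i)) k"
  unfolding cgeo_def
proof (intro conjI allI impI)
  fix j i assume ij: "j \<le> k" "i \<le> j"
  show "d (v (a + i)) (v (a + j)) \<le> j - i + 3"
    using ij assms by (intro cgeo_upper[OF assms(1)]) auto
  show "j - i \<le> d (v (a + i)) (v (a + j)) + 3"
    using ij assms cgeo_lower(2)[OF assms(1), of "a + i" "a + j"] by auto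
qed (use assms in \<open>auto simp: cgeo_def\<close>)

lemma cgeo_rev:
  assumes "cgeo v N" shows "cgeo (\<lambda>i. v (N - i)) N"
  unfolding cgeo_def
proof (intro conjI allI impI)
  fix j i assume ij: "j \<le> N" "i \<le> j"
  show "d (v (N - i)) (v (N - j)) \<le> j - i + 3"
    using ij by (intro cgeo_upper[OF assms]) auto
  show "j - i \<le> d (v (N - i)) (v (N - j)) + 3"
    using ij cgeo_lower(1)[OF assms, of "N - i" "N - j"] by auto
qed (use assms in \<open>auto simp: cgeo_def\<close>)

lemma cgeo_walk:
  assumes "cgeo v N" shows "walk 4 (v ` {..N}) v N"
  unfolding walk_def
proof (intro conjI allI impI)
  fix i assume "i < N"
  then show "d (v i) (v (Suc i)) \<le> 4" using cgeo_upper[OF assms, of i "Suc i" 1] by auto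
qed auto

lemma cgeo_linked:
  assumes "cgeo v N" "i \<le> N" "j \<le> N"
  shows "linked 4 (v ` {..N}) (v i) (v j) (d (v i) (v j) + 3)"
proof -
  have sub: "v ` {..N} \<subseteq> V" using assms unfolding cgeo_def by auto
  have fwd: "linked 4 (v ` {..N}) (v i) (v j) (d (v i) (v j) + 3)" if "i \<le> j" "j \<le> N" for i j
    unfolding linked_def
    using walk_sub[OF cgeo_walk[OF assms(1)], of i "j - i"] that cgeo_lower(2)[OF assms(1), of i j]
    by (intro exI[of _ "\<lambda>k. v (i + k)"] exI[of _ "j - i"]) auto
  show ?thesis
  proof (cases "i \<le> j")
    case False
    then have "linked 4 (v ` {..N}) (v i) (v j) (d (v j) (v i) + 3)"
      using False assms(2) by (intro linked_sym[OF fwd sub]) auto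
    then show ?thesis using sym[OF cgeo_in[OF assms(1,3)] cgeo_in[OF assms(1,2)]] by simp
  qed (use fwd assms in auto)
qed

text \<open>A geodesic through the centre of a ball, closed up by a walk outside the ball, is mapped by
  a pair of Lipschitz functions onto the boundary of a rectangle with sides \<open>2 * \<rho>\<close> and \<open>\<rho>\<close>.\<close>

lemma fat_loop_area:
  fixes \<rho> :: nat
  assumes v: "cgeo v N" "k \<le> N" and w: "walk 4 {u \<in> V. r \<le> d (v k) u} w l" "w 0 = v 0" "w l = v N"
    and \<rho>: "2 * \<rho> + 9 \<le> r"
  shows "\<exists>c f g. walk 4 V c (N + l) \<and> c (N + l) = c 0 \<and> lip f \<and> lip g \<and>
    area f g c (N + l) = 4 * (real \<rho>)\<^sup>2"
proof -
  let ?p = "v k"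
  \<comment> \<open>\<open>\<sigma>\<close> becomes the bottom side of the rectangle,
    \<open>f\<close> the horizontal coordinate (truncated distance from \<open>v 0\<close>, centred
    at \<open>v k\<close>) and \<open>g\<close> the height (truncated distance from
    \<open>\<sigma>\<close>). The 6 absorbs two additive errors of 3, so \<open>f\<close> has
    reached its extreme values where \<open>\<sigma>\<close> ends. Points of \<open>\<sigma>\<close>
    are within \<open>\<rho> + 9\<close> of \<open>v k\<close>, hence \<open>g\<close> equals
    \<open>\<rho>\<close> outside the ball of radius \<open>r\<close>.\<close>
  define \<sigma> where "\<sigma> = v ` {i. i \<le> N \<and> k \<le> i + (\<rho> + 6) \<and> i \<le> k + (\<rho> + 6)}"
  define f where "f = (\<lambda>u. max (- real \<rho>) (min (real \<rho>) (real (d (v 0) u) - real (d (v 0) ?p))))"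
  define g where "g = (\<lambda>u. min (real \<rho>) (real (dset \<sigma> u)))"
  have v0: "v 0 \<in> V" "v N \<in> V" "?p \<in> V" using cgeo_in[OF v(1)] v(2) by auto
  have \<sigma>: "\<sigma> \<subseteq> V" "\<sigma> \<noteq> {}" unfolding \<sigma>_def using cgeo_in[OF v(1)] v(2) by (auto intro: exI[of _ k])
  have "lip f" unfolding lip_def
  proof (intro ballI)
    fix x y assume xy: "x \<in> V" "y \<in> V"
    have "d (v 0) x \<le> d (v 0) y + d y x" "d (v 0) y \<le> d (v 0) x + d x y"
      using xy v0 by (intro triangle; simp)+
    then show "\<bar>f x - f y\<bar> \<le> real (d x y)"
      unfolding f_def using sym[OF xy] by (auto simp: max_def min_def)
  qed
  have "lip g" unfolding lip_def
  proof (intro ballI)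
    fix x y assume xy: "x \<in> V" "y \<in> V"
    have "dset \<sigma> x \<le> d x y + dset \<sigma> y" "dset \<sigma> y \<le> d y x + dset \<sigma> x"
      using xy \<sigma> by (intro dset_lip; simp)+
    then show "\<bar>g x - g y\<bar> \<le> real (d x y)"
      unfolding g_def using sym[OF xy] by (auto simp: min_def)
  qed
  have g_walk: "g u = \<rho>" if u: "u \<in> V" "r \<le> d ?p u" for u
  proof -
    obtain x where x: "x \<in> \<sigma>" "d u x = dset \<sigma> u" using dset_attained[OF \<sigma>(2)] .
    then obtain i where i: "x = v i" "i \<le> N" "k \<le> i + (\<rho> + 6)" "i \<le> k + (\<rho> + 6)"
      unfolding \<sigma>_def by auto
    have "d ?p x \<le> \<rho> + 6 + 3" unfolding i(1) using i v by (intro cgeo_upper[OF v(1)]) auto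
    moreover have "d ?p u \<le> d ?p x + d x u" using x(1) \<sigma>(1) u v0 by (intro triangle) auto
    moreover have "d x u = d u x" using x(1) \<sigma>(1) u by (intro sym) auto
    ultimately have "\<rho> \<le> dset \<sigma> u" using x u \<rho> by linarith
    then show ?thesis unfolding g_def by auto
  qed
  have g_\<sigma>: "g (v i) = 0" if "i \<le> N" "k \<le> i + (\<rho> + 6)" "i \<le> k + (\<rho> + 6)" for i
  proof -
    have "v i \<in> \<sigma>" using that unfolding \<sigma>_def by auto
    then have "dset \<sigma> (v i) \<le> 0" using dset_le[of "v i" \<sigma> "v i"] cgeo_in[OF v(1) that(1)] by simp
    then show ?thesis unfolding g_def by auto
  qed
  have f_right: "f (v i) = \<rho>" if "i \<le> N" "k + (\<rho> + 6) \<le> i" for i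
  proof -
    have "d (v 0) (v i) + 3 \<ge> i" using cgeo_lower(2)[OF v(1), of 0 i] that by auto
    moreover have "d (v 0) ?p \<le> k + 3" using v by (intro cgeo_upper[OF v(1)]) auto
    ultimately show ?thesis unfolding f_def using that by auto
  qed
  have f_left: "f (v i) = - real \<rho>" if "i + (\<rho> + 6) \<le> k" for i
  proof -
    have "d (v 0) (v i) \<le> i + 3" using v that by (intro cgeo_upper[OF v(1)]) auto
    moreover have "d (v 0) ?p + 3 \<ge> k" using cgeo_lower(2)[OF v(1), of 0 k] v by auto
    ultimately show ?thesis unfolding f_def using that by auto
  qed
  have ends: "r \<le> d ?p (v 0)" "r \<le> d ?p (v N)"
    using w unfolding walk_def by force+
  have "d ?p (v 0) \<le> k + 3" using v by (intro cgeo_upper[OF v(1)]) auto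
  then have k0: "0 + (\<rho> + 6) \<le> k" using ends \<rho> by auto
  have "d ?p (v N) \<le> (N - k) + 3" using v by (intro cgeo_upper[OF v(1)]) auto
  then have kN: "k + (\<rho> + 6) \<le> N" using ends \<rho> by auto
  have gends: "g (v 0) = \<rho>" "g (v N) = \<rho>" "g ?p = 0"
    using g_walk ends v0 g_\<sigma>[of k] v by auto
  have fends: "f (v 0) = - real \<rho>" "f (v N) = \<rho>" using f_left[OF k0] f_right[OF _ kN] by auto
  \<comment> \<open>The origin of the plane is the midpoint of the bottom side, so terms along
    \<open>\<sigma>\<close> vanish and the rest telescopes with constant \<open>f\<close>. Each
    vertical side gives \<open>\<rho>\<^sup>2\<close>, and the reversed top side twice that.\<close>
  have left: "area f g v k = (real \<rho>)\<^sup>2"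
  proof -
    have "area f g v k = (\<Sum>i<k. - real \<rho> * (g (v (Suc i)) - g (v i)))"
      unfolding area_def
    proof (intro sum.cong refl)
      fix i assume "i \<in> {..<k}"
      then have i: "i < k" by simp
      show "f (v i) * g (v (Suc i)) - f (v (Suc i)) * g (v i) = - real \<rho> * (g (v (Suc i)) - g (v i))"
      proof (cases "k \<le> i + (\<rho> + 6)")
        case True
        then show ?thesis using g_\<sigma>[of i] g_\<sigma>[of "Suc i"] i v(2) by (cases "k = i + (\<rho> + 6)") auto
      next
        case False
        then show ?thesis using f_left[of i] f_left[of "Suc i"] by (auto simp: algebra_simps)
      qed
    qed
    also have "\<dots> = - real \<rho> * (g ?p - g (v 0))"
      unfolding sum_distrib_left[symmetric] by (simp add: sum_lessThan_telescope[of "\<lambda>i. g (v i)"])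
    finally show ?thesis using gends by (simp add: power2_eq_square)
  qed
  have right: "area f g (\<lambda>i. v (k + i)) (N - k) = (real \<rho>)\<^sup>2"
  proof -
    have "area f g (\<lambda>i. v (k + i)) (N - k) = (\<Sum>i<N - k. real \<rho> * (g (v (k + Suc i)) - g (v (k + i))))"
      unfolding area_def
    proof (intro sum.cong refl)
      fix i assume "i \<in> {..<N - k}"
      then have i: "k + Suc i \<le> N" by auto
      show "f (v (k + i)) * g (v (k + Suc i)) - f (v (k + Suc i)) * g (v (k + i)) =
          real \<rho> * (g (v (k + Suc i)) - g (v (k + i)))"
      proof (cases "i < \<rho> + 6")
        case True
        then show ?thesis using g_\<sigma>[of "k + i"] g_\<sigma>[of "k + Suc i"] i by auto
      next
        case False
        then show ?thesis using f_right[of "k + i"] f_right[of "k + Suc i"] i by (auto simp: algebra_simps)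
      qed
    qed
    also have "\<dots> = real \<rho> * (g (v N) - g ?p)"
      unfolding sum_distrib_left[symmetric] using v(2) by (simp add: sum_lessThan_telescope[of "\<lambda>i. g (v (k + i))", simplified])
    finally show ?thesis using gends by (simp add: power2_eq_square)
  qed
  have outer: "area f g w l = - 2 * (real \<rho>)\<^sup>2"
  proof -
    have "area f g w l = (\<Sum>i<l. - real \<rho> * (f (w (Suc i)) - f (w i)))"
      unfolding area_def
    proof (intro sum.cong refl)
      fix i assume "i \<in> {..<l}"
      then have "g (w i) = \<rho>" "g (w (Suc i)) = \<rho>" using w(1) by (auto simp: walk_def intro!: g_walk)
      then show "f (w i) * g (w (Suc i)) - f (w (Suc i)) * g (w i) = - real \<rho> * (f (w (Suc i)) - f (w i))"
        by (simp add: algebra_simps)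
    qed
    also have "\<dots> = - real \<rho> * (f (w l) - f (w 0))"
      unfolding sum_distrib_left[symmetric] by (simp add: sum_lessThan_telescope[of "\<lambda>i. f (w i)"])
    finally show ?thesis using w fends by (simp add: power2_eq_square)
  qed
  define c where "c = join v N (\<lambda>i. w (l - i))"
  have wv: "walk 4 V v N" using walk_mono[OF cgeo_walk[OF v(1)]] cgeo_in[OF v(1)] by auto
  have ww: "walk 4 V (\<lambda>i. w (l - i)) l" using walk_rev[OF walk_mono[OF w(1), of V 4]] by auto
  have c: "walk 4 V c (N + l)" unfolding c_def using w by (intro walk_join wv ww) auto
  have c0: "c (N + l) = c 0" unfolding c_def join_def using w by auto
  have "area f g v N = area f g v k + area f g (\<lambda>i. v (k + i)) (N - k)"
    using area_shift[of f g v k "N - k"] v(2) by simp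
  moreover have "area f g c (N + l) = area f g v N - area f g w l"
    unfolding c_def by (subst area_join) (use w in \<open>auto simp: area_rev\<close>)
  ultimately have "area f g c (N + l) = 4 * (real \<rho>)\<^sup>2" using left right outer by simp
  then show ?thesis using c c0 \<open>lip f\<close> \<open>lip g\<close> by blast
qed

text \<open>This is all that the thinness argument uses about the space. The threshold
  \<open>R\<close> depends on the slope \<open>M\<close> only, uniformly in the geodesic and the
  centre.\<close>

definition divergent :: bool where
  "divergent \<longleftrightarrow> (\<forall>M. \<exists>R. \<forall>r\<ge>R. \<forall>v N k. cgeo v N \<longrightarrow> k \<le> N \<longrightarrow>
    \<not> linked 4 {u \<in> V. r \<le> d (v k) u} (v 0) (v N) (M * r))"

text \<open>A walk of at most \<open>M * r\<close> steps around the ball also bounds the length of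
  the geodesic it closes up. The loop has length O(r) but encloses area of order
  \<open>r\<^sup>2\<close>, against the subquadratic bound.\<close>

lemma superlinear_divergence:
  assumes sub: "\<And>\<epsilon>. 0 < \<epsilon> \<Longrightarrow> \<exists>N. \<forall>n\<ge>N. \<forall>c f g. walk 4 V c n \<longrightarrow> c n = c 0 \<longrightarrow> lip f \<longrightarrow> lip g \<longrightarrow>
     \<bar>area f g c n\<bar> \<le> \<epsilon> * (real n)\<^sup>2"
  shows divergent
  unfolding divergent_def
proof (intro allI)
  fix M :: nat
  \<comment> \<open>Chosen so that loops of length at most \<open>(5 * M + 3) * r\<close> have
    doubled area at most \<open>r\<^sup>2 / 4\<close>, whereas \<open>4 * \<rho>\<^sup>2\<close> is
    close to \<open>r\<^sup>2\<close>.\<close>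
  define \<epsilon> :: real where "\<epsilon> = 1 / (4 * (5 * real M + 3)\<^sup>2)"
  have "0 < \<epsilon>" unfolding \<epsilon>_def by (auto intro!: divide_pos_pos zero_less_power)
  then obtain N0 where N0: "\<And>n c f g. N0 \<le> n \<Longrightarrow> walk 4 V c n \<Longrightarrow> c n = c 0 \<Longrightarrow> lip f \<Longrightarrow> lip g \<Longrightarrow>
     \<bar>area f g c n\<bar> \<le> \<epsilon> * (real n)\<^sup>2"
    using sub by blast
  show "\<exists>R. \<forall>r\<ge>R. \<forall>v N k. cgeo v N \<longrightarrow> k \<le> N \<longrightarrow>
    \<not> linked 4 {u \<in> V. r \<le> d (v k) u} (v 0) (v N) (M * r)"
  proof (intro exI[of _ "N0 + 30"] allI impI notI)
    fix r v N k
    assume r: "N0 + 30 \<le> r" and v: "cgeo v N" "k \<le> N"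
      and L: "linked 4 {u \<in> V. r \<le> d (v k) u} (v 0) (v N) (M * r)"
    obtain w l where w: "walk 4 {u \<in> V. r \<le> d (v k) u} w l" "w 0 = v 0" "w l = v N" and l: "l \<le> M * r"
      using L unfolding linked_def by blast
    define \<rho> where "\<rho> = (r - 9) div 2"
    have \<rho>: "2 * \<rho> + 9 \<le> r" "r \<le> 2 * \<rho> + 10" unfolding \<rho>_def using r by auto
    obtain c f g where c: "walk 4 V c (N + l)" "c (N + l) = c 0" "lip f" "lip g"
      "area f g c (N + l) = 4 * (real \<rho>)\<^sup>2"
      using fat_loop_area[OF v w \<rho>(1)] by blast
    have "r \<le> d (v k) (v 0)" using w unfolding walk_def by force
    moreover have "d (v k) (v 0) \<le> k + 3" using v by (intro cgeo_upper[OF v(1)]) auto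
    ultimately have "N0 \<le> N + l" using r v by linarith
    then have 1: "4 * (real \<rho>)\<^sup>2 \<le> \<epsilon> * (real (N + l))\<^sup>2" using N0[OF _ c(1-4)] c(5) by simp
    have "walk 4 V w l" using walk_mono[OF w(1), of V 4] by auto
    then have "d (w 0) (w l) \<le> 4 * (l - 0)" by (intro walk_dist) auto
    then have "N \<le> 4 * l + 3" using cgeo_lower(2)[OF v(1), of 0 N] w by auto
    then have "N + l \<le> 5 * (M * r) + 3" using l by linarith
    also have "\<dots> \<le> (5 * M + 3) * r" using r by (auto simp: algebra_simps)
    finally have "real (N + l) \<le> real ((5 * M + 3) * r)" by (rule of_nat_mono)
    then have "real (N + l) \<le> (5 * real M + 3) * real r" by simp
    then have "(real (N + l))\<^sup>2 \<le> ((5 * real M + 3) * real r)\<^sup>2" by (intro power_mono) auto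
    then have "\<epsilon> * (real (N + l))\<^sup>2 \<le> \<epsilon> * ((5 * real M + 3) * real r)\<^sup>2"
      using \<open>0 < \<epsilon>\<close> by (intro mult_left_mono) auto
    also have "\<dots> = (real r)\<^sup>2 / 4"
      unfolding \<epsilon>_def power_mult_distrib by simp
    finally have "(2 * real \<rho>)\<^sup>2 \<le> (real r / 2)\<^sup>2" using 1 by (simp add: power2_eq_square)
    then have "2 * real \<rho> \<le> real r / 2" by (rule power2_le_imp_le) auto
    then show False using \<rho> r by linarith
  qed
qed

text \<open>Let R be the maximal distance to \<open>\<Gamma>\<close>. From two points about 2R
  before and after the maximum, or from the ends of \<open>v\<close>, one walks to nearest points of
  \<open>\<Gamma>\<close> and links those by hypothesis. This avoids the ball of radius R/2 in O(R)
  steps, so divergence bounds R. Bigons and triangles differ only in how the link is found.\<close>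

lemma max_point_bound:
  assumes divergent
  obtains R1 where "\<And>v N \<Gamma> k. cgeo v N \<Longrightarrow> \<Gamma> \<subseteq> V \<Longrightarrow> \<Gamma> \<noteq> {} \<Longrightarrow> k \<le> N \<Longrightarrow>
    (\<And>i. i \<le> N \<Longrightarrow> dset \<Gamma> (v i) \<le> dset \<Gamma> (v k)) \<Longrightarrow>
    2 * dset \<Gamma> (v 0) \<le> dset \<Gamma> (v k) \<Longrightarrow> 2 * dset \<Gamma> (v N) \<le> dset \<Gamma> (v k) \<Longrightarrow>
    (\<And>z1 z2. z1 \<in> \<Gamma> \<Longrightarrow> z2 \<in> \<Gamma> \<Longrightarrow> d z1 z2 \<le> 7 * dset \<Gamma> (v k) \<Longrightarrow> d (v k) z1 \<le> 4 * dset \<Gamma> (v k) \<Longrightarrow>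
      linked 4 {u \<in> V. dset \<Gamma> (v k) \<le> 2 * d (v k) u} z1 z2 (C * dset \<Gamma> (v k))) \<Longrightarrow>
    dset \<Gamma> (v k) < R1"
proof -
  obtain R0 where R0: "\<And>r v N k. R0 \<le> r \<Longrightarrow> cgeo v N \<Longrightarrow> k \<le> N \<Longrightarrow>
      \<not> linked 4 {u \<in> V. r \<le> d (v k) u} (v 0) (v N) ((C + 2) * 3 * r)"
    using assms unfolding divergent_def by blast
  have "dset \<Gamma> (v k) < 2 * R0 + 20"
    if v: "cgeo v N" and \<Gamma>: "\<Gamma> \<subseteq> V" "\<Gamma> \<noteq> {}" and k: "k \<le> N"
      and max: "\<And>i. i \<le> N \<Longrightarrow> dset \<Gamma> (v i) \<le> dset \<Gamma> (v k)"
      and ends: "2 * dset \<Gamma> (v 0) \<le> dset \<Gamma> (v k)" "2 * dset \<Gamma> (v N) \<le> dset \<Gamma> (v k)"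
      and link: "\<And>z1 z2. z1 \<in> \<Gamma> \<Longrightarrow> z2 \<in> \<Gamma> \<Longrightarrow> d z1 z2 \<le> 7 * dset \<Gamma> (v k) \<Longrightarrow> d (v k) z1 \<le> 4 * dset \<Gamma> (v k) \<Longrightarrow>
      linked 4 {u \<in> V. dset \<Gamma> (v k) \<le> 2 * d (v k) u} z1 z2 (C * dset \<Gamma> (v k))"
    for v N \<Gamma> k
  proof (rule ccontr)
    define R where "R = dset \<Gamma> (v k)"
    assume "\<not> ?thesis"
    then have R: "2 * R0 + 20 \<le> R" unfolding R_def by simp
    define X where "X = {u \<in> V. R \<le> 2 * d (v k) u}"
    have p: "v k \<in> V" using cgeo_in[OF v k] .
    \<comment> \<open>There are two reasons for the segment from \<open>v i\<close> to
      \<open>\<Gamma>\<close> to avoid the ball: it has length at most R/2 and ends at distance at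
      least R from the centre, or it has length at most R and starts at distance at least
      2R.\<close>
    have conn: "\<exists>z\<in>\<Gamma>. d (v i) z \<le> R \<and> linked 4 X (v i) z R"
      if i: "i \<le> N" and far: "2 * dset \<Gamma> (v i) \<le> R \<or> 2 * R \<le> d (v k) (v i)" for i
    proof -
      obtain z where z: "z \<in> \<Gamma>" "d (v i) z = dset \<Gamma> (v i)" using dset_attained[OF \<Gamma>(2)] .
      have vi: "v i \<in> V" and zV: "z \<in> V" using cgeo_in[OF v i] z \<Gamma> by auto
      have le: "d (v i) z \<le> R" using z max[OF i] unfolding R_def by simp
      have "{u \<in> V. d (v i) u + d u z = d (v i) z} \<subseteq> X"
      proof
        fix u assume "u \<in> {u \<in> V. d (v i) u + d u z = d (v i) z}"
        then have u: "u \<in> V" "d (v i) u + d u z = d (v i) z" by auto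
        have "R \<le> d (v k) z" unfolding R_def using z by (intro dset_le)
        also have "\<dots> \<le> d (v k) u + d u z" using u p zV by (intro triangle)
        finally have 1: "R \<le> d (v k) u + d u z" .
        have "d (v k) (v i) \<le> d (v k) u + d u (v i)" using u p vi by (intro triangle)
        then have 2: "d (v k) (v i) \<le> d (v k) u + d (v i) u" using sym[OF u(1) vi] by simp
        show "u \<in> X" unfolding X_def using far 1 2 u z(2) le by auto
      qed
      then have "linked 4 X (v i) z R"
        using linked_mono[OF linked_geodesic[OF vi zV]] le by auto
      then show ?thesis using z(1) le by blast
    qed
    \<comment> \<open>The 6 more than covers the additive error 3 in the distance to
      \<open>v k\<close>. Truncated subtraction and \<open>min\<close> stop at the ends of
      \<open>v\<close>, where the hypothesis on the ends takes over.\<close>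
    define i1 where "i1 = k - (2 * R + 6)"
    define i2 where "i2 = min N (k + (2 * R + 6))"
    have i: "i1 \<le> k" "k \<le> i2" "i2 \<le> N" "i2 \<le> i1 + (4 * R + 12)" "k \<le> i1 + (2 * R + 6)"
      unfolding i1_def i2_def using k by auto
    have "2 * dset \<Gamma> (v i1) \<le> R \<or> 2 * R \<le> d (v k) (v i1)"
    proof (cases "2 * R + 6 \<le> k")
      case True
      then show ?thesis using cgeo_lower(1)[OF v k, of i1] i unfolding i1_def by auto
    next
      case False
      then show ?thesis using ends unfolding i1_def R_def by auto
    qed
    then obtain z1 where z1: "z1 \<in> \<Gamma>" "d (v i1) z1 \<le> R" "linked 4 X (v i1) z1 R"
      using conn[of i1] i by auto
    have "2 * dset \<Gamma> (v i2) \<le> R \<or> 2 * R \<le> d (v k) (v i2)"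
    proof (cases "k + (2 * R + 6) \<le> N")
      case True
      then show ?thesis using cgeo_lower(2)[OF v k, of i2] i unfolding i2_def by auto
    next
      case False
      then show ?thesis using ends unfolding i2_def R_def by auto
    qed
    then obtain z2 where z2: "z2 \<in> \<Gamma>" "d (v i2) z2 \<le> R" "linked 4 X (v i2) z2 R"
      using conn[of i2] i by auto
    have V: "v i1 \<in> V" "v i2 \<in> V" "z1 \<in> V" "z2 \<in> V" using cgeo_in[OF v] i z1 z2 \<Gamma> by auto
    have "d (v k) (v i1) \<le> 2 * R + 6 + 3" using i k by (intro cgeo_upper[OF v]) auto
    then have pz1: "d (v k) z1 \<le> 4 * R" using triangle[OF p V(1,3)] z1(2) R by linarith
    have "d (v i1) (v i2) \<le> 4 * R + 12 + 3" using i k by (intro cgeo_upper[OF v]) auto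
    then have "d z1 z2 \<le> 7 * R"
      using triangle[OF V(3,1,4)] triangle[OF V(1,2,4)] sym[OF V(1,3)] z1(2) z2(2) R by linarith
    then have "linked 4 X z1 z2 (C * R)" using link[of z1 z2] z1 z2 pz1 unfolding X_def R_def by simp
    then have "linked 4 X (v i1) (v i2) (R + C * R + R)"
      using linked_trans z1(3) linked_sym[OF z2(3)] unfolding X_def by blast
    \<comment> \<open>The factor 3 instead of 2 pays for the rounding in
      \<open>R div 2\<close>.\<close>
    moreover have "R + C * R + R \<le> (C + 2) * 3 * (R div 2)"
    proof -
      have "(C + 2) * R \<le> (C + 2) * (3 * (R div 2))" using R by (intro mult_left_mono) auto
      then show ?thesis by (simp add: algebra_simps)
    qed
    moreover have "X \<subseteq> {u \<in> V. R div 2 \<le> d (v k) u}" unfolding X_def by auto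
    ultimately have "linked 4 {u \<in> V. R div 2 \<le> d (v k) u} (v i1) (v i2) ((C + 2) * 3 * (R div 2))"
      using linked_mono by blast
    moreover have "cgeo (\<lambda>i. v (i1 + i)) (i2 - i1)" using i by (intro cgeo_sub[OF v]) auto
    ultimately show False
      using R0[of "R div 2" "\<lambda>i. v (i1 + i)" "i2 - i1" "k - i1"] i R
      by (simp add: less_eq_div_iff_mult_less_eq diff_le_mono)
  qed
  then show ?thesis using that by blast
qed

text \<open>With \<open>\<Gamma>\<close> a single coarse geodesic the link simply runs along
  \<open>\<Gamma>\<close>, all of which is at distance at least R from the centre:
  \<open>7 * R + 3\<close> steps suffice. If R exceeds \<open>2 * A\<close>, the condition on the
  ends holds.\<close>

lemma thin_bigons:
  assumes divergent
  obtains R1 where "\<And>v N w L A i. cgeo v N \<Longrightarrow> cgeo w L \<Longrightarrow> dset (w ` {..L}) (v 0) \<le> A \<Longrightarrow>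
    dset (w ` {..L}) (v N) \<le> A \<Longrightarrow> i \<le> N \<Longrightarrow> dset (w ` {..L}) (v i) \<le> max R1 (2 * A)"
proof -
  obtain R1 where R1: "\<And>v N \<Gamma> k. cgeo v N \<Longrightarrow> \<Gamma> \<subseteq> V \<Longrightarrow> \<Gamma> \<noteq> {} \<Longrightarrow> k \<le> N \<Longrightarrow>
    (\<And>i. i \<le> N \<Longrightarrow> dset \<Gamma> (v i) \<le> dset \<Gamma> (v k)) \<Longrightarrow>
    2 * dset \<Gamma> (v 0) \<le> dset \<Gamma> (v k) \<Longrightarrow> 2 * dset \<Gamma> (v N) \<le> dset \<Gamma> (v k) \<Longrightarrow>
    (\<And>z1 z2. z1 \<in> \<Gamma> \<Longrightarrow> z2 \<in> \<Gamma> \<Longrightarrow> d z1 z2 \<le> 7 * dset \<Gamma> (v k) \<Longrightarrow> d (v k) z1 \<le> 4 * dset \<Gamma> (v k) \<Longrightarrow>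
      linked 4 {u \<in> V. dset \<Gamma> (v k) \<le> 2 * d (v k) u} z1 z2 (8 * dset \<Gamma> (v k))) \<Longrightarrow>
    dset \<Gamma> (v k) < R1"
    using max_point_bound[OF assms, of 8] by blast
  have "dset (w ` {..L}) (v i) \<le> max (R1 + 3) (2 * A)"
    if v: "cgeo v N" and w: "cgeo w L" and ends: "dset (w ` {..L}) (v 0) \<le> A"
      "dset (w ` {..L}) (v N) \<le> A" and i: "i \<le> N" for v N w L A i
  proof -
    define \<Gamma> where "\<Gamma> = w ` {..L}"
    obtain k where k: "k \<le> N" "\<And>i. i \<le> N \<Longrightarrow> dset \<Gamma> (v i) \<le> dset \<Gamma> (v k)"
      using exists_max_index[of N "\<lambda>i. dset \<Gamma> (v i)"] by auto
    have \<Gamma>: "\<Gamma> \<subseteq> V" "\<Gamma> \<noteq> {}" unfolding \<Gamma>_def using cgeo_in[OF w] by auto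
    have "dset \<Gamma> (v k) \<le> max (R1 + 3) (2 * A)"
    proof (rule ccontr)
      assume neg: "\<not> ?thesis"
      have "dset \<Gamma> (v k) < R1"
      proof (rule R1[OF v \<Gamma> k])
        fix z1 z2 assume z: "z1 \<in> \<Gamma>" "z2 \<in> \<Gamma>" "d z1 z2 \<le> 7 * dset \<Gamma> (v k)"
        then obtain a b where ab: "a \<le> L" "z1 = w a" "b \<le> L" "z2 = w b" unfolding \<Gamma>_def by auto
        have "linked 4 \<Gamma> z1 z2 (d z1 z2 + 3)"
          unfolding ab \<Gamma>_def using cgeo_linked[OF w ab(1,3)] .
        moreover have "\<Gamma> \<subseteq> {u \<in> V. dset \<Gamma> (v k) \<le> 2 * d (v k) u}"
          using \<Gamma> dset_le[of _ \<Gamma> "v k"] by (auto intro: trans_le_add1 simp: mult_2)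
        ultimately show "linked 4 {u \<in> V. dset \<Gamma> (v k) \<le> 2 * d (v k) u} z1 z2 (8 * dset \<Gamma> (v k))"
          using neg z(3) by (elim linked_mono) auto
      qed (use neg ends in \<open>auto simp: \<Gamma>_def\<close>)
      then show False using neg by auto
    qed
    then show ?thesis using k(2)[OF i] unfolding \<Gamma>_def by linarith
  qed
  then show ?thesis using that by blast
qed

text \<open>The common tip of \<open>a\<close> and \<open>b\<close> may be far away, but by thinness of bigons one can cross over
  from \<open>a\<close> to \<open>b\<close> at distance \<open>O(R)\<close> from \<open>p\<close>.\<close>

lemma detour:
  assumes bigon: "\<And>v N w L A i. cgeo v N \<Longrightarrow> cgeo w L \<Longrightarrow> dset (w ` {..L}) (v 0) \<le> A \<Longrightarrow>
      dset (w ` {..L}) (v N) \<le> A \<Longrightarrow> i \<le> N \<Longrightarrow> dset (w ` {..L}) (v i) \<le> max R1 (2 * A)"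
    and R: "R1 \<le> R" "12 \<le> R" and p: "p \<in> V"
    and a: "cgeo a La" "\<And>i. i \<le> La \<Longrightarrow> R \<le> d p (a i)"
    and b: "cgeo b Lb" "\<And>i. i \<le> Lb \<Longrightarrow> R \<le> d p (b i)"
    and tip: "d (a 0) (b 0) \<le> 3" and j: "j \<le> La" "j' \<le> Lb" "d (a j) (b j') \<le> 7 * R" "d p (a j) \<le> 4 * R"
  shows "linked 4 {u \<in> V. R \<le> 2 * d p u} (a j) (b j') (96 * R)"
proof -
  define X where "X = {u \<in> V. R \<le> 2 * d p u}"
  define \<Gamma> where "\<Gamma> = b ` {..j'}"
  \<comment> \<open>Going back 30R towards the tip from a point within 4R of \<open>p\<close> leads
    about 26R away from \<open>p\<close>. The bigon is at most 14R wide there (twice 7R), so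
    crossing is safe. If the subtraction truncates to 0, the tip itself is reached and crossing
    costs at most 3.\<close>
  define i where "i = j - 30 * R"
  have a': "cgeo a j" and b': "cgeo b j'" using a b j unfolding cgeo_def by auto
  have d0: "dset \<Gamma> (a 0) \<le> 3" using dset_le[of "b 0" \<Gamma> "a 0"] tip unfolding \<Gamma>_def by auto
  have dj: "dset \<Gamma> (a j) \<le> 7 * R" using dset_le[of "b j'" \<Gamma> "a j"] j unfolding \<Gamma>_def by auto
  have "dset \<Gamma> (a i) \<le> max R1 (2 * (7 * R))"
    unfolding \<Gamma>_def using d0 dj R unfolding \<Gamma>_def i_def by (intro bigon[OF a' b']) auto
  then have di: "dset \<Gamma> (a i) \<le> 14 * R" using R by auto
  obtain z where "z \<in> \<Gamma>" and z': "d (a i) z = dset \<Gamma> (a i)" using dset_attained[of \<Gamma>] unfolding \<Gamma>_def by auto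
  then obtain i' where i': "i' \<le> j'" "z = b i'" unfolding \<Gamma>_def by auto
  have V: "a i \<in> V" "a j \<in> V" "z \<in> V" "b j' \<in> V"
    using cgeo_in[OF a(1)] cgeo_in[OF b(1)] j i' unfolding i_def by auto
  have aX: "a ` {..La} \<subseteq> X" unfolding X_def using a cgeo_in[OF a(1)] by (fastforce intro: trans_le_add1 simp: mult_2)
  have bX: "b ` {..Lb} \<subseteq> X" unfolding X_def using b cgeo_in[OF b(1)] by (fastforce intro: trans_le_add1 simp: mult_2)
  have dij: "d (a i) (a j) \<le> 30 * R + 3" unfolding i_def using j by (intro cgeo_upper[OF a(1)]) auto
  have "linked 4 (a ` {..La}) (a j) (a i) (d (a j) (a i) + 3)"
    using j by (intro cgeo_linked[OF a(1)]) (auto simp: i_def)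
  then have 1: "linked 4 X (a j) (a i) (30 * R + 6)"
    using dij sym[OF V(1,2)] aX by (elim linked_mono) auto
  have "{u \<in> V. d (a i) u + d u z = d (a i) z} \<subseteq> X"
  proof
    fix u assume "u \<in> {u \<in> V. d (a i) u + d u z = d (a i) z}"
    then have u: "u \<in> V" "d (a i) u + d u z = d (a i) z" by auto
    show "u \<in> X"
    proof (cases "30 * R \<le> j")
      case True
      then have "i \<le> La" "i + 30 * R = j" using j unfolding i_def by auto
      then have "30 * R \<le> d (a i) (a j) + 3" using cgeo_lower(2)[OF a(1), of i j] j by linarith
      also have "d (a i) (a j) \<le> d (a i) u + d u (a j)" using u V by (intro triangle)
      also have "d u (a j) \<le> d u p + d p (a j)" using u V p by (intro triangle)
      finally have "R \<le> 2 * d p u" using u z' di j(4) sym[OF u(1) p] R by linarith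
      then show ?thesis using u unfolding X_def by simp
    next
      case False
      then have "d u z \<le> 3" using u z' d0 unfolding i_def by simp
      moreover have "R \<le> d p z" using b(2) i' j by auto
      moreover have "d p z \<le> d p u + d u z" using u p V by (intro triangle)
      ultimately show ?thesis using u R unfolding X_def by simp
    qed
  qed
  then have 2: "linked 4 X (a i) z (14 * R)"
    using linked_mono[OF linked_geodesic[OF V(1,3)]] di z' by auto
  have "d z (b j') \<le> 14 * R + (30 * R + 3) + 7 * R"
    using triangle[OF V(3,1,4)] triangle[OF V(1,2,4)] sym[OF V(1,3)] di z' dij j(3) by linarith
  moreover have "linked 4 (b ` {..Lb}) z (b j') (d z (b j') + 3)"
    unfolding i'(2) using j i' by (intro cgeo_linked[OF b(1)]) auto
  ultimately have 3: "linked 4 X z (b j') (51 * R + 6)"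
    using bX by (elim linked_mono) auto
  \<comment> \<open>The total is \<open>95 * R + 12\<close>, which the assumption
    \<open>12 \<le> R\<close> turns into \<open>96 * R\<close>.\<close>
  have "linked 4 X (a j) (b j') (30 * R + 6 + 14 * R + (51 * R + 6))"
    using linked_trans[OF linked_trans[OF 1 2] 3] .
  then show ?thesis unfolding X_def[symmetric] using R by (elim linked_mono) auto
qed

text \<open>Both \<open>a\<close> and \<open>b\<close> start at the vertex opposite to
  \<open>v\<close>, as \<open>detour\<close> wants them. The tolerance 3 is the gap between the last
  sampled vertex of a side and its true end.\<close>

definition coarse_slim :: "nat \<Rightarrow> bool" where
  "coarse_slim \<delta> \<longleftrightarrow> (\<forall>v N a La b Lb. cgeo v N \<longrightarrow> cgeo a La \<longrightarrow> cgeo b Lb \<longrightarrow> d (a 0) (b 0) \<le> 3 \<longrightarrow>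
    d (v 0) (a La) \<le> 3 \<longrightarrow> d (v N) (b Lb) \<le> 3 \<longrightarrow>
    (\<forall>i\<le>N. \<exists>u\<in>a ` {..La} \<union> b ` {..Lb}. d (v i) u \<le> \<delta>))"

text \<open>Here \<open>\<Gamma>\<close> is the union of two sides. Two of its points on the same
  side are linked along that side, two on different sides by \<open>detour\<close>.\<close>

theorem thin_triangles:
  assumes divergent
  shows "\<exists>\<delta>. coarse_slim \<delta>"
proof -
  obtain R1 where bigon: "\<And>v N w L A i. cgeo v N \<Longrightarrow> cgeo w L \<Longrightarrow> dset (w ` {..L}) (v 0) \<le> A \<Longrightarrow>
      dset (w ` {..L}) (v N) \<le> A \<Longrightarrow> i \<le> N \<Longrightarrow> dset (w ` {..L}) (v i) \<le> max R1 (2 * A)"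
    using thin_bigons[OF assms] by blast
  obtain R2 where R2: "\<And>v N \<Gamma> k. cgeo v N \<Longrightarrow> \<Gamma> \<subseteq> V \<Longrightarrow> \<Gamma> \<noteq> {} \<Longrightarrow> k \<le> N \<Longrightarrow>
    (\<And>i. i \<le> N \<Longrightarrow> dset \<Gamma> (v i) \<le> dset \<Gamma> (v k)) \<Longrightarrow>
    2 * dset \<Gamma> (v 0) \<le> dset \<Gamma> (v k) \<Longrightarrow> 2 * dset \<Gamma> (v N) \<le> dset \<Gamma> (v k) \<Longrightarrow>
    (\<And>z1 z2. z1 \<in> \<Gamma> \<Longrightarrow> z2 \<in> \<Gamma> \<Longrightarrow> d z1 z2 \<le> 7 * dset \<Gamma> (v k) \<Longrightarrow> d (v k) z1 \<le> 4 * dset \<Gamma> (v k) \<Longrightarrow>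
      linked 4 {u \<in> V. dset \<Gamma> (v k) \<le> 2 * d (v k) u} z1 z2 (96 * dset \<Gamma> (v k))) \<Longrightarrow>
    dset \<Gamma> (v k) < R2"
    using max_point_bound[OF assms, of 96] by blast
  have "\<exists>u\<in>a ` {..La} \<union> b ` {..Lb}. d (v i) u \<le> R1 + R2 + 12"
    if v: "cgeo v N" and a: "cgeo a La" and b: "cgeo b Lb" and tip: "d (a 0) (b 0) \<le> 3"
      and ends: "d (v 0) (a La) \<le> 3" "d (v N) (b Lb) \<le> 3" and i: "i \<le> N" for v N a La b Lb i
  proof -
    define \<Gamma> where "\<Gamma> = a ` {..La} \<union> b ` {..Lb}"
    have \<Gamma>: "\<Gamma> \<subseteq> V" "\<Gamma> \<noteq> {}" unfolding \<Gamma>_def using cgeo_in[OF a] cgeo_in[OF b] by auto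
    obtain k where k: "k \<le> N" "\<And>i. i \<le> N \<Longrightarrow> dset \<Gamma> (v i) \<le> dset \<Gamma> (v k)"
      using exists_max_index[of N "\<lambda>i. dset \<Gamma> (v i)"] by auto
    define R where "R = dset \<Gamma> (v k)"
    have "R \<le> R1 + R2 + 12"
    proof (rule ccontr)
      assume neg: "\<not> ?thesis"
      have far: "R \<le> d (v k) u" if "u \<in> \<Gamma>" for u unfolding R_def using that by (intro dset_le)
      have "\<Gamma> \<subseteq> {u \<in> V. R \<le> 2 * d (v k) u}"
      proof
        fix u assume "u \<in> \<Gamma>"
        then show "u \<in> {u \<in> V. R \<le> 2 * d (v k) u}" using far[of u] \<Gamma>(1) by auto
      qed
      then have aX: "a ` {..La} \<subseteq> {u \<in> V. R \<le> 2 * d (v k) u}" and bX: "b ` {..Lb} \<subseteq> {u \<in> V. R \<le> 2 * d (v k) u}"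
        unfolding \<Gamma>_def by blast+
      have p: "v k \<in> V" using cgeo_in[OF v k(1)] .
      have det: "linked 4 {u \<in> V. R \<le> 2 * d (v k) u} (a j) (b j') (96 * R)"
        if "cgeo a La" "\<And>i. i \<le> La \<Longrightarrow> R \<le> d (v k) (a i)" "cgeo b Lb" "\<And>i. i \<le> Lb \<Longrightarrow> R \<le> d (v k) (b i)"
          "d (a 0) (b 0) \<le> 3" "j \<le> La" "j' \<le> Lb" "d (a j) (b j') \<le> 7 * R" "d (v k) (a j) \<le> 4 * R"
        for a La b Lb j j'
        by (rule detour[of R1]) (fact bigon that p | use neg in simp)+
      have "R < R2" unfolding R_def
      proof (rule R2[OF v \<Gamma> k], unfold R_def[symmetric])
        fix z1 z2 assume z: "z1 \<in> \<Gamma>" "z2 \<in> \<Gamma>" "d z1 z2 \<le> 7 * R" "d (v k) z1 \<le> 4 * R"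
        consider (aa) j j' where "j \<le> La" "z1 = a j" "j' \<le> La" "z2 = a j'"
          | (bb) j j' where "j \<le> Lb" "z1 = b j" "j' \<le> Lb" "z2 = b j'"
          | (ab) j j' where "j \<le> La" "z1 = a j" "j' \<le> Lb" "z2 = b j'"
          | (ba) j j' where "j \<le> Lb" "z1 = b j" "j' \<le> La" "z2 = a j'"
          using z(1,2) unfolding \<Gamma>_def by auto
        then show "linked 4 {u \<in> V. R \<le> 2 * d (v k) u} z1 z2 (96 * R)"
        proof cases
          case aa
          then have "linked 4 (a ` {..La}) z1 z2 (d z1 z2 + 3)" using cgeo_linked[OF a] by simp
          then show ?thesis using neg z(3) aX by (elim linked_mono) auto
        next
          case bb
          then have "linked 4 (b ` {..Lb}) z1 z2 (d z1 z2 + 3)" using cgeo_linked[OF b] by simp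
          then show ?thesis using neg z(3) bX by (elim linked_mono) auto
        next
          case ab
          show ?thesis unfolding ab(2,4)
            using ab z far by (intro det[OF a _ b _ tip]) (auto simp: \<Gamma>_def)
        next
          case ba
          have "d (b 0) (a 0) \<le> 3" using tip sym[OF cgeo_in[OF a] cgeo_in[OF b]] by simp
          then show ?thesis unfolding ba(2,4)
            using ba z far by (intro det[OF b _ a]) (auto simp: \<Gamma>_def)
        qed
      next
        have "dset \<Gamma> (v 0) \<le> 3" using dset_le[of "a La" \<Gamma> "v 0"] ends unfolding \<Gamma>_def by auto
        then show "2 * dset \<Gamma> (v 0) \<le> R" using neg by auto
        have "dset \<Gamma> (v N) \<le> 3" using dset_le[of "b Lb" \<Gamma> "v N"] ends unfolding \<Gamma>_def by auto
        then show "2 * dset \<Gamma> (v N) \<le> R" using neg by auto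
      qed
      then show False using neg by auto
    qed
    then have "dset \<Gamma> (v i) \<le> R1 + R2 + 12" using k(2)[OF i] unfolding R_def by linarith
    moreover obtain u where "u \<in> \<Gamma>" "d (v i) u = dset \<Gamma> (v i)" using dset_attained[OF \<Gamma>(2)] .
    ultimately have "\<exists>u\<in>\<Gamma>. d (v i) u \<le> R1 + R2 + 12" by metis
    then show ?thesis unfolding \<Gamma>_def .
  qed
  then have "coarse_slim (R1 + R2 + 12)" unfolding coarse_slim_def by blast
  then show ?thesis by blast
qed

section \<open>Triangulations of logarithmic size\<close>

text \<open>Exact geodesics between vertices suffice in this direction, since thinness is now given
  and need not be proved for sides that start inside edges.\<close>

definition dgeo :: "(nat \<Rightarrow> 'a) \<Rightarrow> nat \<Rightarrow> bool" where
  "dgeo v L \<longleftrightarrow> (\<forall>i\<le>L. v i \<in> V) \<and> (\<forall>j\<le>L. \<forall>i\<le>j. d (v i) (v j) = j - i)"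

definition slim :: "nat \<Rightarrow> bool" where
  "slim \<delta> \<longleftrightarrow> (\<forall>v L a La b Lb. dgeo v L \<longrightarrow> dgeo a La \<longrightarrow> dgeo b Lb \<longrightarrow>
    v L = a 0 \<longrightarrow> a La = b 0 \<longrightarrow> b Lb = v 0 \<longrightarrow>
    (\<forall>i\<le>L. \<exists>u\<in>a ` {..La} \<union> b ` {..Lb}. d (v i) u \<le> \<delta>))"

lemma dgeo_exists:
  assumes "x \<in> V" "y \<in> V" obtains v where "dgeo v (d x y)" "v 0 = x" "v (d x y) = y"
  using geodesic[OF assms] unfolding dgeo_def by blast

lemma dgeo_rev:
  assumes "dgeo v L" shows "dgeo (\<lambda>i. v (L - i)) L"
  unfolding dgeo_def
proof (intro conjI allI impI)
  fix j i assume "j \<le> L" "i \<le> j"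
  then have "d (v (L - j)) (v (L - i)) = (L - i) - (L - j)" "v (L - j) \<in> V" "v (L - i) \<in> V"
    using assms unfolding dgeo_def by auto
  then show "d (v (L - i)) (v (L - j)) = j - i"
    using \<open>j \<le> L\<close> \<open>i \<le> j\<close> sym[of "v (L - i)" "v (L - j)"] by simp
qed (use assms in \<open>auto simp: dgeo_def\<close>)

text \<open>Bisect the path and apply slimness to the triangle on its ends and its middle vertex: a
  point of the base is within \<open>\<delta>\<close> of a side spanning one half. After
  \<open>m\<close> bisections at most one edge is left, whose geodesic has no inner
  vertices.\<close>

lemma path_near_geodesic:
  assumes "slim \<delta>" and c: "walk 1 V c n"
  shows "i \<le> j \<Longrightarrow> j \<le> n \<Longrightarrow> j - i \<le> 2 ^ m \<Longrightarrow> dgeo v L \<Longrightarrow> v 0 = c i \<Longrightarrow> v L = c j \<Longrightarrow> t \<le> L \<Longrightarrow>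
    \<exists>k. i \<le> k \<and> k \<le> j \<and> d (v t) (c k) \<le> m * \<delta>"
proof (induction m arbitrary: i j v L t)
  case 0
  have V: "c i \<in> V" "c j \<in> V" using 0 c unfolding walk_def by auto
  have "d (v 0) (v L) = L - 0" using 0(4) unfolding dgeo_def by blast
  then have "L \<le> j - i" using walk_dist[OF c, of i j] 0 by simp
  moreover have "j - i \<le> 1" using 0(3) by simp
  ultimately have "t = 0 \<or> t = L" using 0(7) by linarith
  then show ?case
  proof
    assume "t = 0"
    then show ?thesis using 0 V by (intro exI[of _ i]) auto
  next
    assume "t = L"
    then show ?thesis using 0 V by (intro exI[of _ j]) auto
  qed
next
  case (Suc m)
  define q where "q = i + (j - i) div 2"
  have q: "i \<le> q" "q \<le> j" "q - i \<le> 2 ^ m" "j - q \<le> 2 ^ m" "q \<le> n"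
    unfolding q_def using Suc.prems by auto
  have V: "c i \<in> V" "c j \<in> V" "c q \<in> V" using Suc.prems q c unfolding walk_def by auto
  obtain a where a: "dgeo a (d (c j) (c q))" "a 0 = c j" "a (d (c j) (c q)) = c q"
    using dgeo_exists[OF V(2,3)] .
  obtain b where b: "dgeo b (d (c q) (c i))" "b 0 = c q" "b (d (c q) (c i)) = c i"
    using dgeo_exists[OF V(3,1)] .
  obtain u where u: "u \<in> a ` {..d (c j) (c q)} \<union> b ` {..d (c q) (c i)}" "d (v t) u \<le> \<delta>"
    using assms(1) a b Suc.prems unfolding slim_def by metis
  have "\<exists>k. i \<le> k \<and> k \<le> j \<and> d u (c k) \<le> m * \<delta>"
    using u(1)
  proof
    assume "u \<in> a ` {..d (c j) (c q)}"
    then obtain r where r: "r \<le> d (c j) (c q)" "u = a r" by auto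
    have "\<exists>k. q \<le> k \<and> k \<le> j \<and> d u (c k) \<le> m * \<delta>"
      using Suc.IH[OF q(2) _ q(4) dgeo_rev[OF a(1)], of "d (c j) (c q) - r"] a r Suc.prems by auto
    then show ?thesis using q by (meson le_trans)
  next
    assume "u \<in> b ` {..d (c q) (c i)}"
    then obtain r where r: "r \<le> d (c q) (c i)" "u = b r" by auto
    have "\<exists>k. i \<le> k \<and> k \<le> q \<and> d u (c k) \<le> m * \<delta>"
      using Suc.IH[OF q(1,5,3) dgeo_rev[OF b(1)], of "d (c q) (c i) - r"] b r by auto
    then show ?thesis using q by (meson le_trans)
  qed
  then obtain k where k: "i \<le> k" "k \<le> j" "d u (c k) \<le> m * \<delta>" by blast
  have "v t \<in> V" "u \<in> V" "c k \<in> V"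
    using u a b k Suc.prems c unfolding dgeo_def walk_def by auto
  then have "d (v t) (c k) \<le> \<delta> + m * \<delta>" using triangle[of "v t" u "c k"] u k by linarith
  then show ?case using k by auto
qed

text \<open>A long side is cut at a point of the cycle near the midpoint of a geodesic, a short one next
  to its end.\<close>

lemma slim_triangulation:
  assumes "slim \<delta>" and c: "walk 1 V c n" and n: "n \<le> 2 ^ m"
  shows "i \<le> j \<Longrightarrow> j \<le> n \<Longrightarrow> d (c i) (c j) \<le> 2 * (m * \<delta>) + 2 \<Longrightarrow>
    tri (\<lambda>i j. d (c i) (c j) \<le> 2 * (m * \<delta>) + 2) i j"
proof (induction "j - i" arbitrary: i j rule: less_induct)
  case less
  let ?B = "2 * (m * \<delta>) + 2"
  have cV: "c k \<in> V" if "k \<le> n" for k using c that unfolding walk_def by auto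
  have V: "c i \<in> V" "c j \<in> V" using less.prems cV by auto
  show ?case
  proof (cases "j \<le> i + 2")
    case True
    then show ?thesis using less.prems by (intro tri_small)
  next
    case False
    have cut: "tri (\<lambda>i j. d (c i) (c j) \<le> ?B) i j"
      if "i < k" "k < j" "d (c i) (c k) \<le> ?B" "d (c k) (c j) \<le> ?B" for k
    proof (rule tri_split[OF that(1,2)])
      show "tri (\<lambda>i j. d (c i) (c j) \<le> ?B) i k" "tri (\<lambda>i j. d (c i) (c j) \<le> ?B) k j"
        using that less.prems by (intro less.hyps; linarith)+
    qed (use that in auto)
    show ?thesis
    proof (cases "d (c i) (c j) < ?B")
      case True
      have "d (c i) (c (Suc i)) \<le> 1" using c False less.prems unfolding walk_def by auto
      moreover have "c (Suc i) \<in> V" using cV False less.prems by auto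
      ultimately have "d (c (Suc i)) (c j) \<le> ?B"
        using triangle[of "c (Suc i)" "c i" "c j"] sym[of "c i" "c (Suc i)"] V True by simp
      then show ?thesis using \<open>d (c i) (c (Suc i)) \<le> 1\<close> False by (intro cut[of "Suc i"]) auto
    next
      case False
      then have B: "d (c i) (c j) = ?B" using less.prems by simp
      obtain v where v: "dgeo v (d (c i) (c j))" "v 0 = c i" "v (d (c i) (c j)) = c j"
        using dgeo_exists[OF V] .
      \<comment> \<open>This is the midpoint, because the bound is twice
        \<open>m * \<delta> + 1\<close>. The extra 1 places it farther from both ends than from
        \<open>c k\<close>, so \<open>k\<close> is a genuine apex.\<close>
      define t where "t = m * \<delta> + 1"
      have tB: "t \<le> d (c i) (c j)" "d (c i) (c j) - t = t" unfolding t_def B by auto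
      then have "d (v 0) (v t) = t - 0" "d (v t) (v (d (c i) (c j))) = d (c i) (c j) - t" "v t \<in> V"
        using v(1) unfolding dgeo_def by blast+
      then have t: "t \<le> d (c i) (c j)" "d (c i) (v t) = t" "d (v t) (c j) = t" "v t \<in> V"
        using tB v by simp_all
      have "j - i \<le> 2 ^ m" using n less.prems(2) by linarith
      then obtain k where k: "i \<le> k" "k \<le> j" "d (v t) (c k) \<le> m * \<delta>"
        using path_near_geodesic[OF assms(1) c less.prems(1,2) _ v t(1)] by blast
      have kV: "c k \<in> V" using cV k less.prems by auto
      have "k \<noteq> i" "k \<noteq> j" using k(3) t sym[OF V(1) t(4)] unfolding t_def by auto
      moreover have "d (c i) (c k) \<le> ?B" using triangle[OF V(1) t(4) kV] t k unfolding t_def by linarith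
      moreover have "d (c k) (c j) \<le> ?B"
        using triangle[OF kV t(4) V(2)] sym[OF kV t(4)] t k unfolding t_def by linarith
      ultimately show ?thesis using k by (intro cut) auto
    qed
  qed
qed

end

section \<open>Cayley graphs\<close>

text \<open>A generator must exist to form backtracking edges and to name vertices as points of the
  metric graph. The empty generating set, possible only for the trivial group, is treated separately
  in the final theorem.\<close>

locale cayley = group G for G :: "('a, 'b) monoid_scheme" (structure) +
  fixes S :: "'a set"
  assumes gen: "sym_gen_set G S" and nonempty: "S \<noteq> {}"
begin

section \<open>Words and the word metric\<close>

lemma S_carrier: "S \<subseteq> carrier G" and S_finite: "finite S"
  and S_inv: "s \<in> S \<Longrightarrow> inv s \<in> S" and S_gen: "generate G S = carrier G"
  using gen unfolding sym_gen_set_def by auto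

lemma word_closed: "set w \<subseteq> S \<Longrightarrow> word_eval G w \<in> carrier G"
  unfolding word_eval_def using S_carrier by (induction w) auto

lemma word_append:
  "set w \<subseteq> S \<Longrightarrow> set u \<subseteq> S \<Longrightarrow> word_eval G (w @ u) = word_eval G w \<otimes> word_eval G u"
proof (induction w)
  case Nil
  then show ?case using word_closed[of u] by (simp add: word_eval_def)
next
  case (Cons s w)
  have "word_eval G (s # w @ u) = s \<otimes> word_eval G (w @ u)" by (simp add: word_eval_def)
  also have "\<dots> = (s \<otimes> word_eval G w) \<otimes> word_eval G u"
    using Cons word_closed[of u] word_closed[of w] S_carrier by (simp add: m_assoc subset_iff)
  finally show ?case by (simp add: word_eval_def)
qed

lemma word_single: "s \<in> S \<Longrightarrow> word_eval G [s] = s"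
  using S_carrier by (auto simp: word_eval_def)

lemma word_inverse:
  assumes "set w \<subseteq> S"
  obtains u where "set u \<subseteq> S" "length u = length w" "word_eval G u = inv (word_eval G w)"
proof -
  have "set w \<subseteq> S \<Longrightarrow> word_eval G (rev (map (m_inv G) w)) = inv (word_eval G w) \<and> set (rev (map (m_inv G) w)) \<subseteq> S"
  proof (induction w)
    case Nil
    then show ?case by (simp add: word_eval_def)
  next
    case (Cons s w)
    have s: "s \<in> S" "s \<in> carrier G" "inv s \<in> S" using Cons.prems S_carrier S_inv by auto
    have "word_eval G (rev (map (m_inv G) w) @ [inv s]) = inv (word_eval G w) \<otimes> inv s"
      using Cons s by (subst word_append) (auto simp: word_single)
    also have "\<dots> = inv (s \<otimes> word_eval G w)"
      using s word_closed[of w] Cons.prems by (simp add: inv_mult_group)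
    finally show ?case using Cons s by (simp add: word_eval_def)
  qed
  then show ?thesis using that[of "rev (map (m_inv G) w)"] assms by simp
qed

lemma word_exists:
  assumes "g \<in> carrier G" shows "\<exists>w. set w \<subseteq> S \<and> word_eval G w = g"
proof -
  have "g \<in> generate G S" using assms S_gen by simp
  then show ?thesis
  proof (induction rule: generate.induct)
    case one
    then show ?case by (intro exI[of _ "[]"]) (simp add: word_eval_def)
  next
    case (incl h)
    then show ?case by (intro exI[of _ "[h]"]) (simp add: word_single)
  next
    case (inv h)
    then show ?case by (intro exI[of _ "[inv h]"]) (simp add: word_single S_inv)
  next
    case (eng h1 h2)
    then obtain w u where "set w \<subseteq> S" "word_eval G w = h1" "set u \<subseteq> S" "word_eval G u = h2" by blast
    then show ?case by (intro exI[of _ "w @ u"]) (simp add: word_append)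
  qed
qed

lemma word_len_le: "set w \<subseteq> S \<Longrightarrow> word_len G S (word_eval G w) \<le> length w"
  unfolding word_len_def by (intro Least_le) auto

lemma word_len_attained:
  assumes "g \<in> carrier G"
  obtains w where "set w \<subseteq> S" "length w = word_len G S g" "word_eval G w = g"
proof -
  have "\<exists>n. \<exists>w. set w \<subseteq> S \<and> length w = n \<and> word_eval G w = g" using word_exists[OF assms] by auto
  then have "\<exists>w. set w \<subseteq> S \<and> length w = word_len G S g \<and> word_eval G w = g"
    unfolding word_len_def by (rule LeastI_ex)
  then show ?thesis using that by blast
qed

lemma wdist_self: "x \<in> carrier G \<Longrightarrow> wdist G S x x = 0"
  using word_len_le[of "[]"] by (simp add: wdist_def word_eval_def)

lemma wdist_sym_le:
  assumes "x \<in> carrier G" "y \<in> carrier G" shows "wdist G S y x \<le> wdist G S x y"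
proof -
  obtain w where w: "set w \<subseteq> S" "length w = wdist G S x y" "word_eval G w = inv x \<otimes> y"
    using word_len_attained[of "inv x \<otimes> y"] assms unfolding wdist_def by auto
  obtain u where u: "set u \<subseteq> S" "length u = length w" "word_eval G u = inv (word_eval G w)"
    using word_inverse[OF w(1)] .
  have "word_eval G u = inv y \<otimes> x" using u w assms by (simp add: inv_mult_group)
  then show ?thesis using word_len_le[OF u(1)] u w unfolding wdist_def by simp
qed

lemma wdist_triangle:
  assumes "x \<in> carrier G" "y \<in> carrier G" "z \<in> carrier G"
  shows "wdist G S x z \<le> wdist G S x y + wdist G S y z"
proof -
  obtain w where w: "set w \<subseteq> S" "length w = wdist G S x y" "word_eval G w = inv x \<otimes> y"
    using word_len_attained[of "inv x \<otimes> y"] assms unfolding wdist_def by auto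
  obtain u where u: "set u \<subseteq> S" "length u = wdist G S y z" "word_eval G u = inv y \<otimes> z"
    using word_len_attained[of "inv y \<otimes> z"] assms unfolding wdist_def by auto
  have "(inv x \<otimes> y) \<otimes> (inv y \<otimes> z) = inv x \<otimes> (y \<otimes> inv y) \<otimes> z"
    using assms by (simp only: m_assoc inv_closed m_closed)
  then have "word_eval G (w @ u) = inv x \<otimes> z"
    using word_append[OF w(1) u(1)] w u assms by simp
  then show ?thesis using word_len_le[of "w @ u"] w u unfolding wdist_def by simp
qed

lemma wdist_edge: "x \<in> carrier G \<Longrightarrow> s \<in> S \<Longrightarrow> wdist G S x (x \<otimes> s) \<le> 1"
  using word_len_le[of "[s]"] S_carrier by (auto simp: wdist_def m_assoc[symmetric] word_single subset_iff)

lemma wdist_0: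
  assumes "x \<in> carrier G" "y \<in> carrier G" "wdist G S x y = 0" shows "x = y"
proof -
  obtain w where "length w = 0" "word_eval G w = inv x \<otimes> y"
    using word_len_attained[of "inv x \<otimes> y"] assms unfolding wdist_def by auto
  then have "inv x \<otimes> y = \<one>" by (simp add: word_eval_def)
  then show ?thesis using assms by (metis inv_closed inv_inv inv_equality)
qed

lemma wdist_1:
  assumes "x \<in> carrier G" "y \<in> carrier G" "wdist G S x y = 1" shows "\<exists>s\<in>S. y = x \<otimes> s"
proof -
  obtain w where w: "set w \<subseteq> S" "length w = 1" "word_eval G w = inv x \<otimes> y"
    using word_len_attained[of "inv x \<otimes> y"] assms unfolding wdist_def by auto
  then obtain s where "s \<in> S" "w = [s]" by (auto simp: length_Suc_conv)
  then have "s \<in> S" "inv x \<otimes> y = s" using w word_single by auto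
  then show ?thesis using assms by (intro bexI[of _ s]) (auto simp: m_assoc[symmetric])
qed

text \<open>The prefixes of a shortest word form the geodesic: subwords bound all distances from
  above, and the triangle inequality between the ends leaves no slack.\<close>

lemma wdist_geodesic:
  assumes "x \<in> carrier G" "y \<in> carrier G"
  shows "\<exists>v. v 0 = x \<and> v (wdist G S x y) = y \<and> (\<forall>i\<le>wdist G S x y. v i \<in> carrier G) \<and>
    (\<forall>j\<le>wdist G S x y. \<forall>i\<le>j. wdist G S (v i) (v j) = j - i)"
proof -
  obtain w where w: "set w \<subseteq> S" "length w = wdist G S x y" "word_eval G w = inv x \<otimes> y"
    using word_len_attained[of "inv x \<otimes> y"] assms unfolding wdist_def by auto
  define v where "v = (\<lambda>i. x \<otimes> word_eval G (take i w))"
  let ?n = "wdist G S x y"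
  have sub: "set (take i u) \<subseteq> S" "set (drop i u) \<subseteq> S" if "set u \<subseteq> S" for i u
    using that set_take_subset set_drop_subset by fastforce+
  have vV: "v i \<in> carrier G" for i
    unfolding v_def using assms word_closed[OF sub(1)[OF w(1)]] by simp
  have v0: "v 0 = x" unfolding v_def using assms by (simp add: word_eval_def)
  have vn: "v ?n = y" unfolding v_def using w assms by (simp add: m_assoc[symmetric])
  have upper: "wdist G S (v i) (v j) \<le> j - i" if "i \<le> j" for i j
  proof -
    let ?a = "word_eval G (take i w)" and ?b = "word_eval G (take (j - i) (drop i w))"
    have "take j w = take i w @ take (j - i) (drop i w)"
      using that by (metis le_add_diff_inverse take_add)
    then have "v j = x \<otimes> (?a \<otimes> ?b)"
      unfolding v_def using word_append sub w(1) by metis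
    moreover have "?a \<in> carrier G" "?b \<in> carrier G" using word_closed sub w(1) by auto
    ultimately have "inv (v i) \<otimes> v j = ?b"
      unfolding v_def using assms by (simp add: m_assoc[symmetric]) (simp add: inv_mult_group m_assoc)
    then show ?thesis unfolding wdist_def using word_len_le[of "take (j - i) (drop i w)"] sub w(1)
      by (metis le_trans length_take min.cobounded2)
  qed
  have "wdist G S (v i) (v j) = j - i" if "i \<le> j" "j \<le> ?n" for i j
  proof -
    have "?n \<le> wdist G S x (v i) + wdist G S (v i) y"
      using assms vV by (intro wdist_triangle)
    also have "wdist G S (v i) y \<le> wdist G S (v i) (v j) + wdist G S (v j) y"
      using assms vV by (intro wdist_triangle)
    finally show ?thesis
      using upper[of 0 i] upper[of j ?n] upper[of i j] that v0 vn by simp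
  qed
  then show ?thesis using v0 vn vV by blast
qed

sublocale geodesic_graph "carrier G" "wdist G S"
  using wdist_self wdist_sym_le wdist_triangle wdist_geodesic
  by unfold_locales (auto intro: le_antisym)

section \<open>Triangulations of cycles\<close>

lemma cycle_walk:
  assumes "is_cycle G S c n" shows "walk 1 (carrier G) c n"
  unfolding walk_def
proof (intro conjI allI impI)
  fix i assume "i < n"
  then have "Suc i \<in> {1..n}" "c i \<in> carrier G" using assms unfolding is_cycle_def by auto
  then obtain s where "s \<in> S" "c (Suc i) = c i \<otimes> s"
    using assms unfolding is_cycle_def by (metis diff_Suc_1)
  then show "wdist G S (c i) (c (Suc i)) \<le> 1" using wdist_edge \<open>c i \<in> carrier G\<close> by simp
qed (use assms in \<open>auto simp: is_cycle_def\<close>)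

lemma has_k_triangulation_iff:
  "has_k_triangulation G S c n k \<longleftrightarrow> tri (\<lambda>i j. wdist G S (c i) (c j) \<le> k) 1 n"
  unfolding has_k_triangulation_def circle_triangulation_def tri_def by simp

text \<open>Any triangulation serves, as no chord is longer than the cycle. So the
  \<open>LEAST\<close> in \<open>Delta\<close> ranges over a nonempty set and is attained.\<close>

lemma cycle_has_triangulation:
  assumes "is_cycle G S c m" "m \<le> n" shows "has_k_triangulation G S c m n"
  unfolding has_k_triangulation_iff
proof (rule tri_mono[OF tri_exists])
  fix a b assume "1 \<le> a" "a < b" "b \<le> m"
  then show "wdist G S (c a) (c b) \<le> n"
    using walk_dist[OF cycle_walk[OF assms(1)], of a b] assms by simp
qed (use assms in \<open>auto simp: is_cycle_def\<close>)

lemma Delta_triangulation: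
  assumes "is_cycle G S c m" "m \<le> n" shows "has_k_triangulation G S c m (Delta G S n)"
proof -
  have "\<forall>c m. m \<le> n \<longrightarrow> is_cycle G S c m \<longrightarrow> has_k_triangulation G S c m (Delta G S n)"
    unfolding Delta_def
    by (rule LeastI[of "\<lambda>k. \<forall>c m. m \<le> n \<longrightarrow> is_cycle G S c m \<longrightarrow> has_k_triangulation G S c m k" n])
      (use cycle_has_triangulation in blast)
  then show ?thesis using assms by blast
qed

lemma Delta_le:
  assumes "\<And>c m. m \<le> n \<Longrightarrow> is_cycle G S c m \<Longrightarrow> tri (\<lambda>i j. wdist G S (c i) (c j) \<le> k) 1 m"
  shows "Delta G S n \<le> k"
  unfolding Delta_def using assms by (intro Least_le) (simp add: has_k_triangulation_iff)

lemma Delta_mono: "m \<le> n \<Longrightarrow> Delta G S m \<le> Delta G S n"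
  using Delta_triangulation le_trans by (intro Delta_le) (simp only: has_k_triangulation_iff[symmetric])

section \<open>Subdividing walks into cycles\<close>

definition edge_path :: "nat \<Rightarrow> 'a \<Rightarrow> 'a \<Rightarrow> (nat \<Rightarrow> 'a) \<Rightarrow> nat \<Rightarrow> bool" where
  "edge_path s x y u L \<longleftrightarrow> 1 \<le> L \<and> L \<le> s \<and> u 0 = x \<and> u L = y \<and> (\<forall>i\<le>L. u i \<in> carrier G) \<and>
    (\<forall>i<L. \<exists>t\<in>S. u (Suc i) = u i \<otimes> t) \<and> (\<forall>i\<le>L. wdist G S (u i) y \<le> s)"

text \<open>Equal vertices are joined by a backtracking edge, so that the path is never trivial.\<close>

lemma edge_path_exists:
  assumes "x \<in> carrier G" "y \<in> carrier G" "wdist G S x y \<le> s" "2 \<le> s"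
  shows "\<exists>u L. edge_path s x y u L"
proof (cases "wdist G S x y = 0")
  case True
  then have xy: "x = y" using wdist_0 assms by auto
  obtain t where t: "t \<in> S" using nonempty by auto
  have tc: "t \<in> carrier G" using t S_carrier by auto
  define u where "u = (\<lambda>i::nat. if i = 1 then x \<otimes> t else x)"
  have "x \<otimes> t \<otimes> inv t = x" using assms tc by (simp add: m_assoc)
  then have "\<exists>r\<in>S. u (Suc i) = u i \<otimes> r" if "i < 2" for i
    using that t S_inv[OF t] unfolding u_def by (cases i) force+
  moreover have "wdist G S (x \<otimes> t) x \<le> 1"
    using wdist_edge[OF assms(1) t] wdist_sym_le[of x "x \<otimes> t"] assms tc by simp
  ultimately have "edge_path s x y u 2"
    using assms xy tc unfolding edge_path_def u_def by auto
  then show ?thesis by blast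
next
  case False
  obtain v where v: "dgeo v (wdist G S x y)" "v 0 = x" "v (wdist G S x y) = y"
    using dgeo_exists[OF assms(1,2)] .
  have vV: "v i \<in> carrier G" if "i \<le> wdist G S x y" for i
    using v(1) that unfolding dgeo_def by auto
  have dv: "wdist G S (v i) (v j) = j - i" if "i \<le> j" "j \<le> wdist G S x y" for i j
    using v(1) that unfolding dgeo_def by blast
  have "\<exists>t\<in>S. v (Suc i) = v i \<otimes> t" if "i < wdist G S x y" for i
    using that by (intro wdist_1 vV) (simp_all add: dv)
  moreover have "wdist G S (v i) y \<le> s" if "i \<le> wdist G S x y" for i
    using dv[OF that order_refl] v(3) assms(3) by simp
  ultimately have "edge_path s x y v (wdist G S x y)"
    using v False assms vV unfolding edge_path_def by simp
  then show ?thesis by blast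
qed

text \<open>\<open>e\<close> is \<open>c\<close> subdivided into edges, and \<open>f\<close> sends a
  position on \<open>e\<close> to the end of the step of \<open>c\<close> on which it lies. The
  distinguished points of a circle are numbered from 1, so \<open>f\<close> is controlled only from
  1 on, with \<open>f 1 = 1\<close> and \<open>f N = n\<close> matching the ends of the base
  side.\<close>

definition filling :: "nat \<Rightarrow> (nat \<Rightarrow> 'a) \<Rightarrow> nat \<Rightarrow> (nat \<Rightarrow> 'a) \<Rightarrow> nat \<Rightarrow> (nat \<Rightarrow> nat) \<Rightarrow> bool" where
  "filling s c n e N f \<longleftrightarrow> N \<le> s * n \<and> e 0 = c 0 \<and> e N = c n \<and>
    (\<forall>i\<le>N. e i \<in> carrier G) \<and> (\<forall>i<N. \<exists>t\<in>S. e (Suc i) = e i \<otimes> t) \<and> f N = n \<and>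
    (0 < n \<longrightarrow> 0 < N \<and> f 1 = 1) \<and> (\<forall>p. 1 \<le> p \<longrightarrow> p < N \<longrightarrow> f p \<le> f (Suc p) \<and> f (Suc p) \<le> Suc (f p)) \<and>
    (\<forall>p. 1 \<le> p \<longrightarrow> p \<le> N \<longrightarrow> f p \<le> n \<and> wdist G S (e p) (c (f p)) \<le> s)"

lemma fill:
  assumes "2 \<le> s"
  shows "walk s (carrier G) c n \<Longrightarrow> \<exists>e N f. filling s c n e N f"
proof (induction n)
  case 0
  then show ?case
    by (intro exI[of _ c] exI[of _ 0] exI[of _ "\<lambda>_. 0"]) (auto simp: walk_def filling_def)
next
  case (Suc n)
  have "walk s (carrier G) c n" using Suc.prems unfolding walk_def by auto
  then obtain e N f where F: "filling s c n e N f"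
    using Suc.IH by blast
  from F have e: "N \<le> s * n" "e 0 = c 0" "e N = c n" "\<forall>i\<le>N. e i \<in> carrier G"
    "\<forall>i<N. \<exists>t\<in>S. e (Suc i) = e i \<otimes> t" and f: "f N = n" "0 < n \<longrightarrow> 0 < N \<and> f 1 = 1"
    "\<forall>p. 1 \<le> p \<longrightarrow> p < N \<longrightarrow> f p \<le> f (Suc p) \<and> f (Suc p) \<le> Suc (f p)"
    "\<forall>p. 1 \<le> p \<longrightarrow> p \<le> N \<longrightarrow> f p \<le> n \<and> wdist G S (e p) (c (f p)) \<le> s"
    unfolding filling_def by blast+
  have c: "c n \<in> carrier G" "c (Suc n) \<in> carrier G" "wdist G S (c n) (c (Suc n)) \<le> s"
    using Suc.prems unfolding walk_def by auto
  obtain u L where U: "edge_path s (c n) (c (Suc n)) u L"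
    using edge_path_exists[OF c assms] by blast
  have u: "1 \<le> L" "L \<le> s" "u 0 = c n" "u L = c (Suc n)" "\<And>i. i \<le> L \<Longrightarrow> u i \<in> carrier G"
    "\<And>i. i < L \<Longrightarrow> \<exists>t\<in>S. u (Suc i) = u i \<otimes> t" "\<And>i. i \<le> L \<Longrightarrow> wdist G S (u i) (c (Suc n)) \<le> s"
    using U unfolding edge_path_def by blast+
  define f' where "f' = (\<lambda>p. if p \<le> N then f p else Suc n)"
  have edges: "\<exists>t\<in>S. join e N u (Suc i) = join e N u i \<otimes> t" if "i < N + L" for i
  proof (cases "i < N")
    case True
    then show ?thesis using e(5) unfolding join_def by auto
  next
    case False
    then have "join e N u i = u (i - N)" "join e N u (Suc i) = u (Suc (i - N))"
      using e(3) u(3) unfolding join_def by (auto simp: Suc_diff_le)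
    then show ?thesis using u(6)[of "i - N"] False that by auto
  qed
  show ?case unfolding filling_def
  proof (intro exI conjI)
    show "N + L \<le> s * Suc n" using e u by simp
    show "join e N u 0 = c 0" "join e N u (N + L) = c (Suc n)" using e u unfolding join_def by auto
    show "\<forall>i\<le>N + L. join e N u i \<in> carrier G" using e u unfolding join_def by auto
    show "\<forall>i<N + L. \<exists>t\<in>S. join e N u (Suc i) = join e N u i \<otimes> t" using edges by blast
    show "f' (N + L) = Suc n" using u unfolding f'_def by auto
    show "0 < Suc n \<longrightarrow> 0 < N + L \<and> f' 1 = 1" using u f e(1) unfolding f'_def by (cases n) auto
    show "\<forall>p. 1 \<le> p \<longrightarrow> p < N + L \<longrightarrow> f' p \<le> f' (Suc p) \<and> f' (Suc p) \<le> Suc (f' p)"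
      using f unfolding f'_def by (auto simp: le_less Suc_le_eq)
    show "\<forall>p. 1 \<le> p \<longrightarrow> p \<le> N + L \<longrightarrow> f' p \<le> Suc n \<and> wdist G S (join e N u p) (c (f' p)) \<le> s"
      using f u unfolding f'_def join_def by auto
  qed
qed

text \<open>Triangulate the subdivided cycle and collapse it by \<open>f\<close>. Each end of a
  chord moves by at most \<open>s\<close>, hence the term \<open>2 * s\<close>.\<close>

lemma coarse_triangulation:
  assumes c: "walk s (carrier G) c n" "c n = c 0" and n: "1 \<le> n" and s: "2 \<le> s"
  shows "tri (\<lambda>i j. wdist G S (c i) (c j) \<le> Delta G S (s * n) + 2 * s) 1 n"
proof -
  obtain e N f where F: "filling s c n e N f"
    using fill[OF s c(1)] by blast
  from F have e: "N \<le> s * n" "e 0 = c 0" "e N = c n" "\<forall>i\<le>N. e i \<in> carrier G"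
    "\<forall>i<N. \<exists>t\<in>S. e (Suc i) = e i \<otimes> t" and f: "f N = n" "0 < n \<longrightarrow> 0 < N \<and> f 1 = 1"
    "\<forall>p. 1 \<le> p \<longrightarrow> p < N \<longrightarrow> f p \<le> f (Suc p) \<and> f (Suc p) \<le> Suc (f p)"
    "\<forall>p. 1 \<le> p \<longrightarrow> p \<le> N \<longrightarrow> f p \<le> n \<and> wdist G S (e p) (c (f p)) \<le> s"
    unfolding filling_def by blast+
  have N: "0 < N" "f 1 = 1" using f n by auto
  have "is_cycle G S e N" unfolding is_cycle_def
  proof (intro conjI ballI)
    fix i assume "i \<in> {1..N}"
    then show "\<exists>s\<in>S. e i = e (i - 1) \<otimes> s" using e(5)[rule_format, of "i - 1"] by auto
  qed (use N e c in auto)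
  then have "tri (\<lambda>i j. wdist G S (e i) (e j) \<le> Delta G S (s * n)) 1 N"
    using Delta_triangulation[of e N "s * n"] e(1) has_k_triangulation_iff by blast
  then have "tri (\<lambda>i j. wdist G S (c i) (c j) \<le> Delta G S (s * n) + 2 * s) (f 1) (f N)"
  proof (rule tri_collapse)
    fix a b assume ab: "1 \<le> a" "a < b" "b \<le> N" "wdist G S (e a) (e b) \<le> Delta G S (s * n)"
    then have fa: "f a \<le> n" "wdist G S (e a) (c (f a)) \<le> s" "f b \<le> n" "wdist G S (e b) (c (f b)) \<le> s"
      using f(4) by auto
    have V: "c (f a) \<in> carrier G" "c (f b) \<in> carrier G" "e a \<in> carrier G" "e b \<in> carrier G"
      using c(1) fa e(4) ab unfolding walk_def by auto
    show "wdist G S (c (f a)) (c (f b)) \<le> Delta G S (s * n) + 2 * s"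
      using triangle[OF V(1,3,2)] triangle[OF V(3,4,2)] sym[OF V(1,3)] fa ab by linarith
  qed (use f(3) in auto)
  then show ?thesis using N f(1) by simp
qed

section \<open>From the metric Cayley graph to its vertices\<close>

lemma cg_lower:
  assumes "p \<in> cg_points G S" "q \<in> cg_points G S"
  shows "real (wdist G S (fst p) (fst q)) \<le> cg_dist G S p q + 2"
proof -
  obtain g s t h u r where pq: "p = (g, s, t)" "q = (h, u, r)" by (metis prod_cases3)
  have *: "g \<in> carrier G" "s \<in> S" "0 \<le> t" "t \<le> 1" "h \<in> carrier G" "u \<in> S" "0 \<le> r" "r \<le> 1"
    using assms pq unfolding cg_points_def by auto
  have V: "g \<otimes> s \<in> carrier G" "h \<otimes> u \<in> carrier G" using * S_carrier by auto
  have e: "wdist G S g (g \<otimes> s) \<le> 1" "wdist G S (h \<otimes> u) h \<le> 1"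
    using wdist_edge * sym[OF V(2) *(5)] by auto
  have "wdist G S g h \<le> wdist G S g (h \<otimes> u) + 1" "wdist G S g h \<le> 1 + wdist G S (g \<otimes> s) h"
    "wdist G S (g \<otimes> s) h \<le> wdist G S (g \<otimes> s) (h \<otimes> u) + 1"
    using triangle[OF *(1) V(2) *(5)] triangle[OF *(1) V(1) *(5)] triangle[OF V *(5)] e by linarith+
  then show ?thesis unfolding pq cg_dist_def Let_def using * d_refl[of g] by (auto simp: min_def)
qed

lemma cg_upper:
  assumes "p \<in> cg_points G S" "q \<in> cg_points G S"
  shows "cg_dist G S p q \<le> real (wdist G S (fst p) (fst q)) + 2"
  using assms unfolding cg_points_def cg_dist_def Let_def by (auto simp: min_def)

text \<open>Replacing two points by the initial vertices of their edges changes the distance by at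
  most 2. Rounding a real time down to an integer costs at most 1 more, which is where the constant
  3 of coarse geodesics comes from.\<close>

lemma cg_geodesic_cgeo:
  assumes "cg_geodesic G S gam L x y"
  shows "cgeo (\<lambda>i. fst (gam (real i))) (nat \<lfloor>L\<rfloor>)"
    and "wdist G S (fst (gam (real (nat \<lfloor>L\<rfloor>)))) (fst y) \<le> 3"
    and "\<And>a. a \<in> {0..L} \<Longrightarrow> nat \<lfloor>a\<rfloor> \<le> nat \<lfloor>L\<rfloor> \<and> wdist G S (fst (gam a)) (fst (gam (real (nat \<lfloor>a\<rfloor>)))) \<le> 3"
    and "\<And>i. i \<le> nat \<lfloor>L\<rfloor> \<Longrightarrow> real i \<in> {0..L}"
    and "fst (gam (real 0)) = fst x"
    and "\<And>a. a \<in> {0..L} \<Longrightarrow> fst (gam a) \<in> carrier G"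
proof -
  have L: "0 \<le> L" "gam 0 = x" "gam L = y" and pts: "\<And>a. a \<in> {0..L} \<Longrightarrow> gam a \<in> cg_points G S"
    and dist: "\<And>a b. a \<in> {0..L} \<Longrightarrow> b \<in> {0..L} \<Longrightarrow> cg_dist G S (gam a) (gam b) = \<bar>a - b\<bar>"
    using assms unfolding cg_geodesic_def by auto
  show inL: "real i \<in> {0..L}" if "i \<le> nat \<lfloor>L\<rfloor>" for i using that L by (simp add: le_nat_floor) linarith
  show carr: "fst (gam a) \<in> carrier G" if "a \<in> {0..L}" for a
    using pts[OF that] unfolding cg_points_def by auto
  have close: "\<bar>real (wdist G S (fst (gam a)) (fst (gam b))) - \<bar>a - b\<bar>\<bar> \<le> 2"
    if "a \<in> {0..L}" "b \<in> {0..L}" for a b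
    using cg_lower[OF pts pts, OF that] cg_upper[OF pts pts, OF that] dist[OF that] by simp
  show near: "nat \<lfloor>a\<rfloor> \<le> nat \<lfloor>L\<rfloor> \<and> wdist G S (fst (gam a)) (fst (gam (real (nat \<lfloor>a\<rfloor>)))) \<le> 3" if a: "a \<in> {0..L}" for a
  proof -
    have 1: "nat \<lfloor>a\<rfloor> \<le> nat \<lfloor>L\<rfloor>" using a by (intro nat_mono floor_mono) auto
    have "\<bar>a - real (nat \<lfloor>a\<rfloor>)\<bar> \<le> 1" using a by simp linarith
    then have "real (wdist G S (fst (gam a)) (fst (gam (real (nat \<lfloor>a\<rfloor>))))) \<le> 3"
      using close[OF a inL[OF 1]] by linarith
    then show ?thesis using 1 by simp
  qed
  show "wdist G S (fst (gam (real (nat \<lfloor>L\<rfloor>)))) (fst y) \<le> 3"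
    using near[of L] L sym[OF carr carr, of L "real (nat \<lfloor>L\<rfloor>)"] inL[of "nat \<lfloor>L\<rfloor>"] by simp
  show "fst (gam (real 0)) = fst x" using L by simp
  show "cgeo (\<lambda>i. fst (gam (real i))) (nat \<lfloor>L\<rfloor>)"
    unfolding cgeo_def
  proof (intro conjI allI impI)
    fix i j assume ij: "j \<le> nat \<lfloor>L\<rfloor>" "i \<le> j"
    then have "\<bar>real i - real j\<bar> = real (j - i)" by auto
    then show "wdist G S (fst (gam (real i))) (fst (gam (real j))) \<le> j - i + 3"
      "j - i \<le> wdist G S (fst (gam (real i))) (fst (gam (real j))) + 3"
      using close[OF inL inL, of i j] ij by linarith+
  qed (use carr inL in auto)
qed

lemma linear_Delta_hyperbolic:
  assumes "\<forall>n\<ge>1. real (Delta G S n) \<le> real n / 6 + K"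
  shows "hyperbolic_wrt G S"
proof -
  \<comment> \<open>The 8 is the loss \<open>2 * s\<close> of \<open>coarse_triangulation\<close>
    for step size 4.\<close>
  obtain K' :: nat where K': "K + 8 \<le> real K'" using real_arch_simple by blast
  have divergent
  proof (rule superlinear_divergence, rule area_subquadratic)
    fix c n assume c: "1 \<le> n" "walk 4 (carrier G) c n" "c n = c 0"
    have "real (Delta G S (4 * n)) \<le> real (4 * n) / 6 + K"
      using c(1) by (intro assms[rule_format]) auto
    then have "real (6 * (Delta G S (4 * n) + 2 * 4)) \<le> real (4 * n + 6 * K')" using K' by simp
    then have *: "6 * (Delta G S (4 * n) + 2 * 4) \<le> 4 * n + 6 * K'" by (simp only: of_nat_le_iff)
    show "tri (\<lambda>i j. 6 * wdist G S (c i) (c j) \<le> 4 * n + 6 * K') 1 n"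
      by (rule tri_mono[OF coarse_triangulation[OF c(2,3,1)]]) (use * in auto)
  qed
  then obtain \<delta> where \<delta>: "coarse_slim \<delta>"
    using thin_triangles by blast
  \<comment> \<open>Of the 5, rounding the time costs 3 and returning from vertices to points costs
    2. The other two sides follow by cyclic symmetry.\<close>
  have side: "side_close G S (real \<delta> + 5) g1 L1 g2 L2 g3 L3"
    if g: "cg_geodesic G S g1 L1 x y" "cg_geodesic G S g2 L2 y z" "cg_geodesic G S g3 L3 z x"
    for g1 L1 g2 L2 g3 L3 x y z
    unfolding side_close_def
  proof
    fix a assume a: "a \<in> {0..L1}"
    note c1 = cg_geodesic_cgeo[OF g(1)] and c2 = cg_geodesic_cgeo[OF g(2)] and c3 = cg_geodesic_cgeo[OF g(3)]
    define v1 where "v1 = (\<lambda>i. fst (g1 (real i)))"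
    \<comment> \<open>Reversed, so that it starts at \<open>z\<close> like
      \<open>v3\<close>.\<close>
    define v2 where "v2 = (\<lambda>i. fst (g2 (real (nat \<lfloor>L2\<rfloor> - i))))"
    define v3 where "v3 = (\<lambda>i. fst (g3 (real i)))"
    have vert: "fst x \<in> carrier G" "fst y \<in> carrier G" "fst z \<in> carrier G"
      using c1(6)[of 0] c2(6)[of 0] c3(6)[of 0] g unfolding cg_geodesic_def by auto
    have geo: "cgeo v1 (nat \<lfloor>L1\<rfloor>)" "cgeo v2 (nat \<lfloor>L2\<rfloor>)" "cgeo v3 (nat \<lfloor>L3\<rfloor>)"
      unfolding v1_def v2_def v3_def using c1(1) cgeo_rev[OF c2(1)] c3(1) by auto
    have "\<exists>u\<in>v3 ` {..nat \<lfloor>L3\<rfloor>} \<union> v2 ` {..nat \<lfloor>L2\<rfloor>}. wdist G S (v1 (nat \<lfloor>a\<rfloor>)) u \<le> \<delta>"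
    proof (rule \<delta>[unfolded coarse_slim_def, rule_format, OF geo(1,3,2)])
      have "wdist G S (v2 0) (fst z) \<le> 3" "v2 0 \<in> carrier G" "v3 0 = fst z"
        using c2(2) c3(5) cgeo_in[OF geo(2), of 0] unfolding v2_def v3_def by auto
      then show "wdist G S (v3 0) (v2 0) \<le> 3" using sym[OF vert(3)] by simp
      have "wdist G S (v3 (nat \<lfloor>L3\<rfloor>)) (fst x) \<le> 3" "v1 0 = fst x"
        using c3(2) c1(5) unfolding v1_def v3_def by auto
      then show "wdist G S (v1 0) (v3 (nat \<lfloor>L3\<rfloor>)) \<le> 3"
        using sym[OF vert(1) cgeo_in[OF geo(3)]] by simp
      show "wdist G S (v1 (nat \<lfloor>L1\<rfloor>)) (v2 (nat \<lfloor>L2\<rfloor>)) \<le> 3"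
        using c1(2) c2(5) unfolding v1_def v2_def by simp
    qed (use c1(3)[OF a] in auto)
    then obtain u where u: "u \<in> v3 ` {..nat \<lfloor>L3\<rfloor>} \<union> v2 ` {..nat \<lfloor>L2\<rfloor>}" "wdist G S (v1 (nat \<lfloor>a\<rfloor>)) u \<le> \<delta>"
      by blast
    have "\<exists>p \<in> g2 ` {0..L2} \<union> g3 ` {0..L3}. fst p = u"
      using u(1)
    proof
      assume "u \<in> v3 ` {..nat \<lfloor>L3\<rfloor>}"
      then show ?thesis using c3(4) unfolding v3_def by fastforce
    next
      assume "u \<in> v2 ` {..nat \<lfloor>L2\<rfloor>}"
      then show ?thesis using c2(4)[OF diff_le_self] unfolding v2_def by fastforce
    qed
    then obtain p where p: "p \<in> g2 ` {0..L2} \<union> g3 ` {0..L3}" "fst p = u" by blast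
    have pts: "p \<in> cg_points G S" "g1 a \<in> cg_points G S"
      using p(1) a g unfolding cg_geodesic_def by auto
    have fstV: "fst q \<in> carrier G" if "q \<in> cg_points G S" for q
      using that unfolding cg_points_def by auto
    have V: "fst (g1 a) \<in> carrier G" "u \<in> carrier G" "v1 (nat \<lfloor>a\<rfloor>) \<in> carrier G"
      using fstV[OF pts(2)] fstV[OF pts(1)] p(2) c1(3)[OF a] cgeo_in[OF geo(1)] by simp_all
    have "wdist G S (fst (g1 a)) u \<le> 3 + \<delta>"
      using triangle[OF V(1,3,2)] c1(3)[OF a] u(2) unfolding v1_def by linarith
    then have "cg_dist G S (g1 a) p \<le> real \<delta> + 5" using cg_upper[OF pts(2,1)] p(2) by simp
    then show "\<exists>p\<in>g2 ` {0..L2} \<union> g3 ` {0..L3}. cg_dist G S (g1 a) p \<le> real \<delta> + 5" using p(1) by blast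
  qed
  show ?thesis unfolding hyperbolic_wrt_def
    by (intro exI[of _ "real \<delta> + 5"] allI impI conjI) (auto intro: side)
qed

section \<open>Hyperbolicity and change of generators\<close>

definition edge_label :: "'a \<Rightarrow> 'a \<Rightarrow> 'a" where
  "edge_label x y = (SOME s. s \<in> S \<and> y = x \<otimes> s)"

text \<open>A vertex is represented by many triples, but the sides of a triangle must share their
  ends as triples. The fixed label \<open>s0\<close> at integer times makes the ends agree.\<close>

definition param :: "'a \<Rightarrow> (nat \<Rightarrow> 'a) \<Rightarrow> real \<Rightarrow> 'a \<times> 'a \<times> real" where
  "param s0 v a = (let k = nat \<lfloor>a\<rfloor> in
    if a = real k then (v k, s0, 0) else (v k, edge_label (v k) (v (Suc k)), a - real k))"

lemma param_geodesic:
  assumes v: "dgeo v L" and s0: "s0 \<in> S"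
  shows "cg_geodesic G S (param s0 v) (real L) (v 0, s0, 0) (v L, s0, 0)"
proof -
  have vV: "v i \<in> carrier G" if "i \<le> L" for i using v that unfolding dgeo_def by auto
  have dle: "wdist G S (v i) (v j) = j - i" if "i \<le> j" "j \<le> L" for i j
    using v that unfolding dgeo_def by blast
  have dv: "real (wdist G S (v i) (v j)) = \<bar>real i - real j\<bar>" if "i \<le> L" "j \<le> L" for i j
    using dle[of i j] dle[of j i] sym[OF vV vV, OF that] that by (cases "i \<le> j") auto
  have label: "edge_label (v k) (v (Suc k)) \<in> S \<and> v (Suc k) = v k \<otimes> edge_label (v k) (v (Suc k))"
    if "Suc k \<le> L" for k
  proof -
    have "wdist G S (v k) (v (Suc k)) = 1" using dle[of k "Suc k"] that by simp
    then have "\<exists>s. s \<in> S \<and> v (Suc k) = v k \<otimes> s" using wdist_1[of "v k" "v (Suc k)"] vV that by auto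
    then show ?thesis unfolding edge_label_def by (rule someI_ex)
  qed
  text \<open>The label of a vertex is the arbitrary \<open>s0\<close>, so the far end of its edge need not lie on the
    path.\<close>
  have point: "\<exists>k s t. param s0 v a = (v k, s, t) \<and> s \<in> S \<and> a = real k + t \<and> 0 \<le> t \<and> t < 1 \<and> k \<le> L \<and>
      (t = 0 \<or> (Suc k \<le> L \<and> v k \<otimes> s = v (Suc k)))" if a: "a \<in> {0..real L}" for a
  proof -
    define k where "k = nat \<lfloor>a\<rfloor>"
    have k: "real k \<le> a" "a < real k + 1" unfolding k_def using a by simp_all
    show ?thesis
    proof (cases "a = real k")
      case True
      then have "k \<le> L" using a by simp
      moreover have "param s0 v a = (v k, s0, 0)" unfolding param_def k_def[symmetric] Let_def using True by simp
      ultimately show ?thesis using True s0 by (intro exI[of _ k] exI[of _ s0] exI[of _ 0]) auto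
    next
      case False
      then have "real k < real L" using k a by auto
      then have kL: "Suc k \<le> L" by simp
      moreover have "param s0 v a = (v k, edge_label (v k) (v (Suc k)), a - real k)"
        unfolding param_def k_def[symmetric] Let_def using False by simp
      ultimately show ?thesis using k label[OF kL]
        by (intro exI[of _ k] exI[of _ "edge_label (v k) (v (Suc k))"] exI[of _ "a - real k"]) auto
    qed
  qed
  have step: "\<bar>real (wdist G S (x \<otimes> s) y) - real (wdist G S x y)\<bar> \<le> 1"
    if "x \<in> carrier G" "y \<in> carrier G" "s \<in> S" for x y s
  proof -
    have xs: "x \<otimes> s \<in> carrier G" using that S_carrier by auto
    have "wdist G S x (x \<otimes> s) \<le> 1" using that by (intro wdist_edge)
    then show ?thesis
      using triangle[OF that(1) xs that(2)] triangle[OF xs that(1,2)] sym[OF that(1) xs] by linarith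
  qed
  have dist: "cg_dist G S (param s0 v a) (param s0 v b) = \<bar>a - b\<bar>"
    if a: "a \<in> {0..real L}" and b: "b \<in> {0..real L}" for a b
  proof -
    obtain k s t where p: "param s0 v a = (v k, s, t)" "s \<in> S" "a = real k + t" "0 \<le> t" "t < 1" "k \<le> L"
      "t = 0 \<or> (Suc k \<le> L \<and> v k \<otimes> s = v (Suc k))" using point[OF a] by blast
    obtain l u r where q: "param s0 v b = (v l, u, r)" "u \<in> S" "b = real l + r" "0 \<le> r" "r < 1" "l \<le> L"
      "r = 0 \<or> (Suc l \<le> L \<and> v l \<otimes> u = v (Suc l))" using point[OF b] by blast
    have V: "v k \<otimes> s \<in> carrier G" "v l \<otimes> u \<in> carrier G" "v k \<in> carrier G" "v l \<in> carrier G"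
      using p q vV S_carrier by auto
    define A where "A = real (wdist G S (v k) (v l))"
    define B where "B = real (wdist G S (v k) (v l \<otimes> u))"
    define C where "C = real (wdist G S (v k \<otimes> s) (v l))"
    define D where "D = real (wdist G S (v k \<otimes> s) (v l \<otimes> u))"
    have A: "A = \<bar>real k - real l\<bar>" unfolding A_def using dv p q by simp
    \<comment> \<open>If \<open>r\<close> is 0 the far end of the edge is unknown. The estimate by 1
      is then enough, since reaching that end costs the whole edge.\<close>
    have B: "\<bar>B - A\<bar> \<le> 1" "r \<noteq> 0 \<Longrightarrow> B = \<bar>real k - real l - 1\<bar>"
      unfolding A_def B_def
      using step[OF V(4,3) q(2)] sym[OF V(3,4)] sym[OF V(3,2)] q(7) dv[OF p(6), of "Suc l"] by auto
    have C: "\<bar>C - A\<bar> \<le> 1" "t \<noteq> 0 \<Longrightarrow> C = \<bar>real k + 1 - real l\<bar>"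
      unfolding A_def C_def using step[OF V(3,4) p(2)] p(7) dv[OF _ q(6), of "Suc k"] by (auto simp: add.commute)
    have D: "\<bar>D - C\<bar> \<le> 1" "\<bar>D - B\<bar> \<le> 1" "t \<noteq> 0 \<Longrightarrow> r \<noteq> 0 \<Longrightarrow> D = \<bar>real k - real l\<bar>"
      unfolding B_def C_def D_def
      using step[OF V(4,1) q(2)] sym[OF V(1,4)] sym[OF V(1,2)] step[OF V(3,2) p(2)] p(7) q(7) dv[of "Suc k" "Suc l"] by auto
    have same: "k = l" if "v k = v l"
      using A that V unfolding A_def by simp
    have eq: "cg_dist G S (param s0 v a) (param s0 v b) =
      (if v k = v l \<and> s = u then min \<bar>t - r\<bar> (min (min (t + A + r) (t + B + (1 - r))) (min (1 - t + C + r) (1 - t + D + (1 - r))))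
       else min (min (t + A + r) (t + B + (1 - r))) (min (1 - t + C + r) (1 - t + D + (1 - r))))"
      unfolding p(1) q(1) cg_dist_def Let_def A_def B_def C_def D_def by simp
    note ab = p(3-5) q(3-5)
    have lower1: "\<bar>a - b\<bar> \<le> t + A + r" using A ab by linarith
    have lower2: "\<bar>a - b\<bar> \<le> t + B + (1 - r)"
    proof (cases "r = 0")
      case True
      then show ?thesis using A B(1) ab by linarith
    next
      case False
      then show ?thesis using B(2)[OF False] ab by linarith
    qed
    have lower3: "\<bar>a - b\<bar> \<le> 1 - t + C + r"
    proof (cases "t = 0")
      case True
      then show ?thesis using A C(1) ab by linarith
    next
      case False
      then show ?thesis using C(2)[OF False] ab by linarith
    qed
    have lower4: "\<bar>a - b\<bar> \<le> 1 - t + D + (1 - r)"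
    proof (cases "r = 0")
      case True
      then show ?thesis using lower3 D(1) by linarith
    next
      case r: False
      show ?thesis
      proof (cases "t = 0")
        case True
        then show ?thesis using lower2 D(2) by linarith
      next
        case False
        then show ?thesis using D(3)[OF False r] ab by linarith
      qed
    qed
    note lower = lower1 lower2 lower3 lower4
    \<comment> \<open>For different edges the minimum is attained through the ends facing each
      other, with the vertex itself when the parameter is 0.\<close>
    consider "k < l" | "l < k" | "k = l" "t = 0 \<or> r = 0" | "k = l" "t \<noteq> 0" "r \<noteq> 0" by linarith
    then show ?thesis
    proof cases
      case 1
      then have kl: "real k + 1 \<le> real l" by linarith
      have "\<bar>a - b\<bar> = t + A + r \<or> \<bar>a - b\<bar> = 1 - t + C + r"
      proof (cases "t = 0")
        case True
        then have "\<bar>a - b\<bar> = t + A + r" using A ab kl by linarith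
        then show ?thesis ..
      next
        case False
        then have "\<bar>a - b\<bar> = 1 - t + C + r" using C(2)[OF False] ab kl by linarith
        then show ?thesis ..
      qed
      then have "min (min (t + A + r) (t + B + (1 - r))) (min (1 - t + C + r) (1 - t + D + (1 - r))) = \<bar>a - b\<bar>"
        by (intro min_four_eqI lower) auto
      then show ?thesis unfolding eq using same 1 by auto
    next
      case 2
      then have kl: "real l + 1 \<le> real k" by linarith
      have "\<bar>a - b\<bar> = t + A + r \<or> \<bar>a - b\<bar> = t + B + (1 - r)"
      proof (cases "r = 0")
        case True
        then have "\<bar>a - b\<bar> = t + A + r" using A ab kl by linarith
        then show ?thesis ..
      next
        case False
        then have "\<bar>a - b\<bar> = t + B + (1 - r)" using B(2)[OF False] ab kl by linarith
        then show ?thesis ..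
      qed
      then have "min (min (t + A + r) (t + B + (1 - r))) (min (1 - t + C + r) (1 - t + D + (1 - r))) = \<bar>a - b\<bar>"
        by (intro min_four_eqI lower) auto
      then show ?thesis unfolding eq using same 2 by auto
    next
      case 3
      then have e: "\<bar>a - b\<bar> = t + A + r" "\<bar>a - b\<bar> = \<bar>t - r\<bar>" using A ab by auto
      have "min (min (t + A + r) (t + B + (1 - r))) (min (1 - t + C + r) (1 - t + D + (1 - r))) = \<bar>a - b\<bar>"
        using e(1) by (intro min_four_eqI lower) auto
      then show ?thesis unfolding eq using e(2) by simp
    next
      case 4
      \<comment> \<open>Cancellation makes the two labels equal, so the direct distance inside the
        common edge is available.\<close>
      then have "v k \<otimes> s = v (Suc k)" "v k \<otimes> u = v (Suc k)" using p(7) q(7) by auto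
      then have "inv (v k) \<otimes> (v k \<otimes> s) = inv (v k) \<otimes> (v k \<otimes> u)" by simp
      moreover have "s \<in> carrier G" "u \<in> carrier G" using p(2) q(2) S_carrier by auto
      ultimately have "s = u" using V(3) by (simp add: m_assoc[symmetric])
      moreover have "\<bar>a - b\<bar> = \<bar>t - r\<bar>" using 4 ab by auto
      moreover have "\<bar>a - b\<bar> \<le> min (min (t + A + r) (t + B + (1 - r))) (min (1 - t + C + r) (1 - t + D + (1 - r)))"
        using lower by simp
      ultimately show ?thesis unfolding eq using 4 by simp
    qed
  qed
  show ?thesis unfolding cg_geodesic_def
  proof (intro conjI ballI)
    show "param s0 v 0 = (v 0, s0, 0)" "param s0 v (real L) = (v L, s0, 0)"
      unfolding param_def by (simp_all add: Let_def)
    show "param s0 v a \<in> cg_points G S" if "a \<in> {0..real L}" for a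
      using point[OF that] vV unfolding cg_points_def by fastforce
  qed (use dist in auto)
qed

lemma param_vertex:
  assumes "a \<in> {0..real L}" shows "fst (param s0 v a) \<in> v ` {..L}"
proof -
  have "nat \<lfloor>a\<rfloor> \<le> L" using assms by (simp add: nat_le_iff floor_le_iff)
  then show ?thesis unfolding param_def by (simp add: Let_def)
qed

lemma hyperbolic_slim:
  assumes "hyperbolic_wrt G S" shows "\<exists>\<delta>. slim \<delta>"
proof -
  obtain \<delta> where \<delta>: "\<And>x y z g1 L1 g2 L2 g3 L3. cg_geodesic G S g1 L1 x y \<Longrightarrow> cg_geodesic G S g2 L2 y z \<Longrightarrow>
      cg_geodesic G S g3 L3 z x \<Longrightarrow> side_close G S \<delta> g1 L1 g2 L2 g3 L3"
    using assms unfolding hyperbolic_wrt_def by metis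
  obtain s0 where s0: "s0 \<in> S" using nonempty by auto
  obtain \<delta>' :: nat where \<delta>': "\<delta> + 2 \<le> real \<delta>'" using real_arch_simple by blast
  have "\<exists>u\<in>a ` {..La} \<union> b ` {..Lb}. wdist G S (v i) u \<le> \<delta>'"
    if v: "dgeo v L" "dgeo a La" "dgeo b Lb" and e: "v L = a 0" "a La = b 0" "b Lb = v 0" and i: "i \<le> L"
    for v L a La b Lb i
  proof -
    have g: "cg_geodesic G S (param s0 v) (real L) (v 0, s0, 0) (v L, s0, 0)"
      "cg_geodesic G S (param s0 a) (real La) (v L, s0, 0) (b 0, s0, 0)"
      "cg_geodesic G S (param s0 b) (real Lb) (b 0, s0, 0) (v 0, s0, 0)"
      using param_geodesic[OF v(1) s0] param_geodesic[OF v(2) s0] param_geodesic[OF v(3) s0] e by auto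
    have iL: "real i \<in> {0..real L}" using i by simp
    have "\<exists>p \<in> param s0 a ` {0..real La} \<union> param s0 b ` {0..real Lb}. cg_dist G S (param s0 v (real i)) p \<le> \<delta>"
      using \<delta>[OF g] iL unfolding side_close_def by (rule bspec)
    then obtain p where p: "p \<in> param s0 a ` {0..real La} \<union> param s0 b ` {0..real Lb}"
      "cg_dist G S (param s0 v (real i)) p \<le> \<delta>" by (rule bexE)
    have pts: "\<forall>r\<in>{0..l}. gam r \<in> cg_points G S" if "cg_geodesic G S gam l x y" for gam l x y
      using that unfolding cg_geodesic_def by (elim conjE)
    have "p \<in> cg_points G S" using p(1) pts[OF g(2)] pts[OF g(3)] by blast
    moreover have "param s0 v (real i) \<in> cg_points G S" using pts[OF g(1)] iL by (rule bspec)
    ultimately have "real (wdist G S (v i) (fst p)) \<le> \<delta> + 2"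
      using cg_lower[of "param s0 v (real i)" p] p(2) by (simp add: param_def)
    then have "wdist G S (v i) (fst p) \<le> \<delta>'" using \<delta>' by linarith
    moreover have "fst p \<in> a ` {..La} \<union> b ` {..Lb}" using p(1) param_vertex by blast
    ultimately show ?thesis by blast
  qed
  then have "slim \<delta>'" unfolding slim_def by blast
  then show ?thesis by blast
qed

lemma hyperbolic_log_Delta:
  assumes "hyperbolic_wrt G S"
  shows "\<exists>C. \<forall>n\<ge>1. real (Delta G S n) \<le> C * (log 2 (real n) + 1) + 2"
proof -
  obtain \<delta> where \<delta>: "slim \<delta>" using hyperbolic_slim[OF assms] by blast
  have "real (Delta G S n) \<le> 2 * real \<delta> * (log 2 (real n) + 1) + 2" if n: "1 \<le> n" for n
  proof -
    define m where "m = nat \<lceil>log 2 (real n)\<rceil>"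
    have log0: "0 \<le> log 2 (real n)" using n by simp
    have m: "log 2 (real n) \<le> real m" "real m \<le> log 2 (real n) + 1" unfolding m_def using log0 by linarith+
    have "real n = 2 powr log 2 (real n)" using n by simp
    also have "\<dots> \<le> 2 powr real m" using m(1) by simp
    also have "\<dots> = real (2 ^ m)" by (simp add: powr_realpow)
    finally have n2: "n \<le> 2 ^ m" by (simp only: of_nat_le_iff)
    have "Delta G S n \<le> 2 * (m * \<delta>) + 2"
    proof (rule Delta_le)
      fix c k assume c: "k \<le> n" "is_cycle G S c k"
      have w: "walk 1 (carrier G) c k" using cycle_walk[OF c(2)] .
      have k: "1 \<le> k" "c k = c 0" using c(2) unfolding is_cycle_def by auto
      then have "c 0 \<in> carrier G" "c 1 \<in> carrier G" "wdist G S (c 0) (c 1) \<le> 1"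
        using w unfolding walk_def by auto
      \<comment> \<open>The base side joins \<open>c 1\<close> to \<open>c k = c 0\<close>, so it is
        an edge and the recursion may start.\<close>
      then have "wdist G S (c 1) (c k) \<le> 2 * (m * \<delta>) + 2" using k sym[of "c 1" "c 0"] by simp
      then show "tri (\<lambda>i j. wdist G S (c i) (c j) \<le> 2 * (m * \<delta>) + 2) 1 k"
        using c(1) n2 k by (intro slim_triangulation[OF \<delta> w]) auto
    qed
    then have "real (Delta G S n) \<le> real (2 * (m * \<delta>) + 2)" by (simp only: of_nat_le_iff)
    also have "\<dots> = 2 * real \<delta> * real m + 2" by simp
    also have "\<dots> \<le> 2 * real \<delta> * (log 2 (real n) + 1) + 2" using m by (intro add_right_mono mult_left_mono) auto
    finally show ?thesis .
  qed
  then show ?thesis by blast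
qed

end

section \<open>Change of generating set\<close>

lemma word_metrics_comparable:
  assumes "cayley G S" "cayley G T"
  shows "\<exists>M. \<forall>x\<in>carrier G. \<forall>y\<in>carrier G. wdist G T x y \<le> M * wdist G S x y"
proof -
  interpret S: cayley G S by fact
  interpret T: cayley G T by fact
  define M where "M = Max (word_len G T ` S)"
  have M: "word_len G T s \<le> M" if "s \<in> S" for s
    unfolding M_def using that S.S_finite by (intro Max_ge) auto
  have "wdist G T x y \<le> M * wdist G S x y" if xy: "x \<in> carrier G" "y \<in> carrier G" for x y
  proof -
    obtain v where v: "S.dgeo v (wdist G S x y)" "v 0 = x" "v (wdist G S x y) = y"
      using S.dgeo_exists[OF xy] .
    have vV: "v i \<in> carrier G" if "i \<le> wdist G S x y" for i
      using v(1) that unfolding S.dgeo_def by auto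
    have "T.walk M (carrier G) v (wdist G S x y)" unfolding T.walk_def
    proof (intro conjI allI impI)
      fix i assume i: "i < wdist G S x y"
      then have "wdist G S (v i) (v (Suc i)) = 1"
        using v(1) unfolding S.dgeo_def by (metis Suc_leI diff_Suc_1 diff_add_inverse2 le_SucI order_refl plus_1_eq_Suc add.commute)
      then obtain s where s: "s \<in> S" "v (Suc i) = v i \<otimes>\<^bsub>G\<^esub> s"
        using S.wdist_1[of "v i" "v (Suc i)"] vV i by auto
      then have "inv\<^bsub>G\<^esub> (v i) \<otimes>\<^bsub>G\<^esub> v (Suc i) = s"
        using vV[of i] i S.S_carrier by (auto simp: S.m_assoc[symmetric])
      then show "wdist G T (v i) (v (Suc i)) \<le> M" unfolding wdist_def using M[OF s(1)] by simp
    qed (use vV in auto)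
    then show ?thesis using T.walk_dist[of M v "wdist G S x y" 0 "wdist G S x y"] v by simp
  qed
  then show ?thesis by blast
qed

text \<open>For \<open>S\<close>, a \<open>T\<close>-cycle is just a closed walk with bounded steps.
  \<open>coarse_triangulation\<close> applies to it directly, and its chords are then measured again
  in \<open>T\<close>.\<close>

lemma Delta_change_generators:
  assumes "cayley G S" "cayley G T"
  shows "\<exists>M s. 1 \<le> s \<and> (\<forall>n\<ge>1. Delta G T n \<le> M * (Delta G S (s * n) + 2 * s))"
proof -
  interpret S: cayley G S by fact
  interpret T: cayley G T by fact
  obtain M where M: "\<And>x y. x \<in> carrier G \<Longrightarrow> y \<in> carrier G \<Longrightarrow> wdist G T x y \<le> M * wdist G S x y"
    using word_metrics_comparable[OF assms] by blast
  obtain s0 where s0: "\<And>x y. x \<in> carrier G \<Longrightarrow> y \<in> carrier G \<Longrightarrow> wdist G S x y \<le> s0 * wdist G T x y"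
    using word_metrics_comparable[OF assms(2,1)] by blast
  \<comment> \<open>At least 2, to allow backtracking edges.\<close>
  define s where "s = max 2 s0"
  have "Delta G T n \<le> M * (Delta G S (s * n) + 2 * s)" for n
  proof (rule T.Delta_le)
    fix c m assume c: "m \<le> n" "is_cycle G T c m"
    have w: "T.walk 1 (carrier G) c m" using T.cycle_walk[OF c(2)] .
    have V: "c i \<in> carrier G" if "i \<le> m" for i using w that unfolding T.walk_def by auto
    have "S.walk s (carrier G) c m" unfolding S.walk_def
    proof (intro conjI allI impI)
      fix i assume i: "i < m"
      then have "wdist G T (c i) (c (Suc i)) \<le> 1" using w unfolding T.walk_def by auto
      then have "s0 * wdist G T (c i) (c (Suc i)) \<le> s0 * 1" by (intro mult_le_mono2)
      moreover have "wdist G S (c i) (c (Suc i)) \<le> s0 * wdist G T (c i) (c (Suc i))"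
        using V i by (intro s0) auto
      ultimately show "wdist G S (c i) (c (Suc i)) \<le> s" unfolding s_def by linarith
    qed (use V in auto)
    then have "tri (\<lambda>i j. wdist G S (c i) (c j) \<le> Delta G S (s * m) + 2 * s) 1 m"
      using c(2) by (intro S.coarse_triangulation) (auto simp: s_def is_cycle_def)
    then show "tri (\<lambda>i j. wdist G T (c i) (c j) \<le> M * (Delta G S (s * n) + 2 * s)) 1 m"
    proof (rule tri_mono)
      fix a b assume ab: "1 \<le> a" "a < b" "b \<le> m" "wdist G S (c a) (c b) \<le> Delta G S (s * m) + 2 * s"
      have "Delta G S (s * m) \<le> Delta G S (s * n)" using c(1) by (intro S.Delta_mono) simp
      then have "M * wdist G S (c a) (c b) \<le> M * (Delta G S (s * n) + 2 * s)"
        using ab(4) by (intro mult_le_mono2) linarith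
      then show "wdist G T (c a) (c b) \<le> M * (Delta G S (s * n) + 2 * s)"
        using M[OF V V, of a b] ab by linarith
    qed
  qed
  then show ?thesis by (intro exI[of _ M] exI[of _ s]) (auto simp: s_def)
qed

text \<open>The factor \<open>s\<close> in the length becomes an additive constant under the
  logarithm, so the shape of the bound is preserved.\<close>

lemma Delta_log_all_generators:
  assumes "cayley G S" "cayley G T" "hyperbolic_wrt G S"
  shows "\<exists>Q R. \<forall>n::nat. 1 \<le> n \<longrightarrow> real (Delta G T n) \<le> Q * log 2 (real n) + R"
proof -
  obtain C where C: "\<And>n. 1 \<le> n \<Longrightarrow> real (Delta G S n) \<le> C * (log 2 (real n) + 1) + 2"
    using cayley.hyperbolic_log_Delta[OF assms(1,3)] by blast
  obtain M s where s: "1 \<le> s" and M: "\<And>n. 1 \<le> n \<Longrightarrow> Delta G T n \<le> M * (Delta G S (s * n) + 2 * s)"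
    using Delta_change_generators[OF assms(1,2)] by blast
  have "real (Delta G T n) \<le> (real M * C) * log 2 (real n) + real M * (C * log 2 (real s) + C + 2 + 2 * real s)"
    if n: "1 \<le> n" for n
  proof -
    have "real (Delta G T n) \<le> real (M * (Delta G S (s * n) + 2 * s))" using M[OF n] by (simp only: of_nat_le_iff)
    also have "\<dots> = real M * (real (Delta G S (s * n)) + 2 * real s)" by simp
    also have "\<dots> \<le> real M * (C * (log 2 (real (s * n)) + 1) + 2 + 2 * real s)"
      using C[of "s * n"] s n by (intro mult_left_mono add_right_mono) auto
    also have "log 2 (real (s * n)) = log 2 (real s) + log 2 (real n)"
      using s n by (simp add: log_mult)
    finally show ?thesis by (simp add: algebra_simps)
  qed
  then show ?thesis by blast
qed

text \<open>The bound \<open>ln x \<le> x - 1\<close> at \<open>x = n / (6 * q)\<close> yields slope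
  exactly 1/6. The maximum with 1 keeps \<open>q\<close> positive for arbitrary
  \<open>Q\<close>.\<close>

lemma log_le_linear:
  fixes Q R :: real
  shows "\<exists>K. \<forall>n::nat. 1 \<le> n \<longrightarrow> Q * log 2 (real n) + R \<le> real n / 6 + K"
proof -
  define q where "q = max Q 1 / ln 2"
  have q: "0 < q" unfolding q_def by (auto intro!: divide_pos_pos)
  have "Q * log 2 (real n) + R \<le> real n / 6 + (q * ln (6 * q) + R)" if n: "1 \<le> n" for n :: nat
  proof -
    have "Q * log 2 (real n) \<le> max Q 1 * log 2 (real n)" using n by (intro mult_right_mono) auto
    also have "\<dots> = q * ln (real n)" unfolding q_def log_def by simp
    also have "ln (real n) = ln (real n / (6 * q)) + ln (6 * q)" using n q by (simp add: ln_div)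
    also have "q * \<dots> \<le> q * (real n / (6 * q) + ln (6 * q))"
      using ln_le_minus_one[of "real n / (6 * q)"] n q by (intro mult_left_mono add_right_mono) auto
    also have "\<dots> = real n / 6 + q * ln (6 * q)" using q by (simp add: field_simps)
    finally show ?thesis by simp
  qed
  then show ?thesis by blast
qed

section \<open>Assembling the equivalence\<close>

lemma sym_gen_set_exists:
  assumes "group G" "finitely_generated G" obtains S where "sym_gen_set G S"
proof -
  interpret group G by fact
  obtain T where T: "finite T" "T \<subseteq> carrier G" "generate G T = carrier G"
    using assms(2) unfolding finitely_generated_def by blast
  define S where "S = T \<union> m_inv G ` T"
  have S: "S \<subseteq> carrier G" unfolding S_def using T(2) by auto
  have "generate G T \<subseteq> generate G S" unfolding S_def by (intro mono_generate) auto
  then have "generate G S = carrier G" using T(3) generate_incl[OF S] by auto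
  moreover have "m_inv G s \<in> S" if "s \<in> S" for s
    using that T(2) unfolding S_def by auto
  ultimately have "sym_gen_set G S" unfolding sym_gen_set_def using T(1) S by (auto simp: S_def)
  then show ?thesis using that by blast
qed

theorem theoremB:
  fixes G :: "('a, 'b) monoid_scheme"
  assumes "group G" and "finitely_generated G"
  shows "((\<exists>S. sym_gen_set G S \<and> (\<exists>K::real. \<forall>n::nat. n \<ge> 1 \<longrightarrow>
              real (Delta G S n) \<le> real n / 6 + K))
          \<longleftrightarrow> hyperbolic_group G)
       \<and> (hyperbolic_group G \<longleftrightarrow>
          (\<forall>S. sym_gen_set G S \<longrightarrow> (\<exists>Q R::real. \<forall>n::nat. n \<ge> 1 \<longrightarrow>
              real (Delta G S n) \<le> Q * log 2 (real n) + R)))"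
    (is "(?linear \<longleftrightarrow> _) \<and> (_ \<longleftrightarrow> ?log)")
proof -
  interpret group G by fact
  have cay: "cayley G S" if "sym_gen_set G S" "S \<noteq> {}" for S
    using that by unfold_locales
  have "hyperbolic_group G" if linear: ?linear
  proof -
    obtain S K where S: "sym_gen_set G S" and K: "\<forall>n\<ge>1. real (Delta G S n) \<le> real n / 6 + K"
      using linear by blast
    have "hyperbolic_wrt G S"
    proof (cases "S = {}")
      case True
      \<comment> \<open>Without edges the metric graph has no points, so hyperbolicity holds
        vacuously.\<close>
      have "\<not> cg_geodesic G {} g L x y" for g L and x y :: "'a \<times> 'a \<times> real"
        unfolding cg_geodesic_def cg_points_def by fastforce
      then show ?thesis unfolding hyperbolic_wrt_def True by blast
    next
      case False
      then show ?thesis using cayley.linear_Delta_hyperbolic[OF cay[OF S] K] by blast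
    qed
    then show ?thesis using S unfolding hyperbolic_group_def by blast
  qed
  moreover have ?log if hyp: "hyperbolic_group G"
  proof (intro allI impI)
    fix T assume T: "sym_gen_set G T"
    obtain S where S: "sym_gen_set G S" "hyperbolic_wrt G S" using hyp unfolding hyperbolic_group_def by blast
    consider "T = {}" | "T \<noteq> {}" "S = {}" | "T \<noteq> {}" "S \<noteq> {}" by blast
    then show "\<exists>Q R::real. \<forall>n::nat. n \<ge> 1 \<longrightarrow> real (Delta G T n) \<le> Q * log 2 (real n) + R"
    proof cases
      case 1
      \<comment> \<open>A cycle has at least one edge, so there is none without generators.\<close>
      have "\<not> is_cycle G T c m" for c m unfolding is_cycle_def 1 by auto
      then have "Delta G T n \<le> 0" for n unfolding Delta_def by (intro Least_le) blast
      then show ?thesis by (intro exI[of _ 0]) simp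
    next
      case 2
      interpret T: cayley G T using cay[OF T 2(1)] .
      \<comment> \<open>The hyperbolic generating set is empty, so the group is trivial and all
        chords have length 0, although \<open>T\<close> may still contain the identity.\<close>
      have "carrier G = {\<one>\<^bsub>G\<^esub>}" using S(1) 2(2) generate_empty unfolding sym_gen_set_def by auto
      then have zero: "wdist G T x y = 0" if "x \<in> carrier G" "y \<in> carrier G" for x y
        using T.d_refl that by auto
      have "Delta G T n \<le> 0" for n
      proof (rule T.Delta_le)
        fix c m assume "m \<le> n" and c: "is_cycle G T c m"
        show "tri (\<lambda>i j. wdist G T (c i) (c j) \<le> 0) 1 m"
          by (rule tri_mono[OF tri_exists]) (use c zero in \<open>auto simp: is_cycle_def\<close>)
      qed
      then show ?thesis by (intro exI[of _ 0]) simp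
    next
      case 3
      then show ?thesis using Delta_log_all_generators[OF cay[OF S(1)] cay[OF T] S(2)] by blast
    qed
  qed
  moreover have ?linear if log: ?log
  proof -
    \<comment> \<open>The logarithmic bound is universal in the generating set and the linear one
      existential; finite generation supplies an instance.\<close>
    obtain S where S: "sym_gen_set G S" using sym_gen_set_exists[OF assms] .
    then obtain Q R where QR: "\<And>n::nat. n \<ge> 1 \<Longrightarrow> real (Delta G S n) \<le> Q * log 2 (real n) + R"
      using log by blast
    obtain K where "\<And>n::nat. 1 \<le> n \<Longrightarrow> Q * log 2 (real n) + R \<le> real n / 6 + K"
      using log_le_linear by blast
    then show ?thesis using S QR order_trans by meson
  qed
  ultimately show ?thesis by blast
qed

end
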